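(* Statement (G) implies statement (A), where: (G) For every finite metric space $(F,\rho)$ there exist a finite metric space $(F',\rho')$, an isometric embedding $I:(F,\rho)\to(F',\rho')$ and a map $T:\mathrm{PISO}(F)\to \mathrm{ISO}(F')$ such that: 1. for each partial isometry $h\in \mathrm{PISO}(F)$, the isometry $T(h)$ of $F'$ extends $h$, i.e. $I(hx)=[T(h)](Ix)$ for all $x$ in the domain of $h$; 2. for each subset $K\subset F$ (in particular for $K=F$) the restriction of $T$ to the group $\mathrm{ISO}(K)\subset \mathrm{PISO}(F)$ is a group homomorphism $\mathrm{ISO}(K)\to \mathrm{ISO}(F')$, i.e. $T(g_1g_2)=T(g_1)T(g_2)$ for all $g_1,g_2\in \mathrm{ISO}(K)$. (A) The group $\mathrm{ISO}(\mathbb{U})$ of isometries of the Urysohn space $\mathbb{U}$ contains an everywhere dense locally finite subgroup, and the group $\mathrm{ISO}(\mathbb{QU})$ of isometries of the rational Urysohn space $\mathbb{QU}$ contains an everywhere dense locally finite subgroup.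
   Context: For a metric space $X$, $\mathrm{ISO}(X)$ is the group of all isometries of $X$ onto itself. A partial isometry of $X$ is a distance-preserving bijection from one subset of $X$ onto another subset of $X$ (the empty map, with empty domain, is allowed); $\mathrm{PISO}(X)$ is the set of all partial isometries of $X$. For $K\subset X$ (with the induced metric), elements of $\mathrm{ISO}(K)$ are regarded as partial isometries of $X$ with domain and range $K$. The Urysohn space $\mathbb{U}$ is the (unique up to isometry) complete separable metric space that contains an isometric copy of every separable metric space and is ultrahomogeneous: every isometry between two finite subsets extends to an isometry of the whole space onto itself. The rational Urysohn space $\mathbb{QU}$ is the (unique up to isometry) countable metric space with rational distances that contains an isometric copy of every finite metric space with rational distances and is ultrahomogeneous in the same sense. A group is locally finite if each of its finitely generated subgroups is finite. Density in $\mathrm{ISO}(\mathbb{U})$ is with respect to the topology of pointwise convergence on $\mathbb{U}$. Density in $\mathrm{ISO}(\mathbb{QU})$ is with respect to pointwise convergence with $\mathbb{QU}$ regarded as a discrete set: a subgroup $H$ is dense if for every $g\in\mathrm{ISO}(\mathbb{QU})$ and every finite $E\subset\mathbb{QU}$ there is $h\in H$ with $h(x)=g(x)$ for all $x\in E$. *)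

theory Defs
  imports "HOL-Analysis.Analysis" "HOL-Algebra.Bij" "HOL-Algebra.Generated_Groups"
begin

text \<open>
  A metric space is a carrier set \<open>M\<close> with a distance function \<open>d\<close>
  satisfying \<^locale>\<open>Metric_space\<close>. As in \<^const>\<open>Bij\<close>, an isometry of \<open>M\<close> onto
  itself is a function that is extensional on \<open>M\<close>, so that distinct functions are
  distinct elements of the group.
\<close>

definition isometries :: "'a set \<Rightarrow> ('a \<Rightarrow> 'a \<Rightarrow> real) \<Rightarrow> ('a \<Rightarrow> 'a) set" where
  "isometries M d = {f \<in> Bij M. \<forall>x\<in>M. \<forall>y\<in>M. d (f x) (f y) = d x y}"

definition ISO :: "'a set \<Rightarrow> ('a \<Rightarrow> 'a \<Rightarrow> real) \<Rightarrow> ('a \<Rightarrow> 'a) monoid" where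
  "ISO M d = BijGroup M \<lparr>carrier := isometries M d\<rparr>"

text \<open>
  A partial isometry is a partial function: its domain is \<open>dom h\<close> and its range is
  \<open>ran h\<close>. The empty map is included.
\<close>

definition PISO :: "'a set \<Rightarrow> ('a \<Rightarrow> 'a \<Rightarrow> real) \<Rightarrow> ('a \<rightharpoonup> 'a) set" where
  "PISO M d = {h. dom h \<subseteq> M \<and> ran h \<subseteq> M \<and> inj_on h (dom h) \<and>
     (\<forall>x\<in>dom h. \<forall>y\<in>dom h. d (the (h x)) (the (h y)) = d x y)}"

text \<open>An element of \<open>ISO K d\<close>, for \<open>K \<subseteq> M\<close>, regarded as an element of \<open>PISO M d\<close>:\<close>

definition as_partial :: "'a set \<Rightarrow> ('a \<Rightarrow> 'a) \<Rightarrow> ('a \<rightharpoonup> 'a)" where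
  "as_partial K g = (\<lambda>x. Some (g x)) |` K"

definition isometric_embedding ::
    "'a set \<Rightarrow> ('a \<Rightarrow> 'a \<Rightarrow> real) \<Rightarrow> 'b set \<Rightarrow> ('b \<Rightarrow> 'b \<Rightarrow> real) \<Rightarrow> ('a \<Rightarrow> 'b) \<Rightarrow> bool" where
  "isometric_embedding M d M' d' i \<longleftrightarrow>
     i \<in> M \<rightarrow> M' \<and> (\<forall>x\<in>M. \<forall>y\<in>M. d' (i x) (i y) = d x y)"

definition ultrahomogeneous :: "'a set \<Rightarrow> ('a \<Rightarrow> 'a \<Rightarrow> real) \<Rightarrow> bool" where
  "ultrahomogeneous M d \<longleftrightarrow>
     (\<forall>h\<in>PISO M d. finite (dom h) \<longrightarrow>
        (\<exists>g\<in>carrier (ISO M d). \<forall>x\<in>dom h. h x = Some (g x)))"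

text \<open>
  HOL formulas cannot quantify over types, so the test spaces below live on fixed types.
  No generality is lost: a separable metric space has at most continuum many points, hence
  is isometric to one whose carrier is a set of reals, and a finite metric space is
  isometric to one whose carrier is a set of natural numbers.
\<close>

definition Urysohn_space :: "'a set \<Rightarrow> ('a \<Rightarrow> 'a \<Rightarrow> real) \<Rightarrow> bool" where
  "Urysohn_space U d \<longleftrightarrow>
     Metric_space U d \<and>
     Metric_space.mcomplete U d \<and>
     separable_space (Metric_space.mtopology U d) \<and>
     (\<forall>(S :: real set) s. Metric_space S s \<and> separable_space (Metric_space.mtopology S s) \<longrightarrow>
        (\<exists>i. isometric_embedding S s U d i)) \<and>
     ultrahomogeneous U d"

definition rational_distances :: "'a set \<Rightarrow> ('a \<Rightarrow> 'a \<Rightarrow> real) \<Rightarrow> bool" where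
  "rational_distances M d \<longleftrightarrow> (\<forall>x\<in>M. \<forall>y\<in>M. d x y \<in> \<rat>)"

definition rational_Urysohn_space :: "'a set \<Rightarrow> ('a \<Rightarrow> 'a \<Rightarrow> real) \<Rightarrow> bool" where
  "rational_Urysohn_space Q d \<longleftrightarrow>
     Metric_space Q d \<and>
     countable Q \<and>
     rational_distances Q d \<and>
     (\<forall>(F :: nat set) r. Metric_space F r \<and> finite F \<and> rational_distances F r \<longrightarrow>
        (\<exists>i. isometric_embedding F r Q d i)) \<and>
     ultrahomogeneous Q d"

definition locally_finite_group :: "('g, 'm) monoid_scheme \<Rightarrow> bool" where
  "locally_finite_group G \<longleftrightarrow>
     group G \<and> (\<forall>A. A \<subseteq> carrier G \<and> finite A \<longrightarrow> finite (generate G A))"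

definition pointwise_topology :: "'a set \<Rightarrow> ('a \<Rightarrow> 'a \<Rightarrow> real) \<Rightarrow> ('a \<Rightarrow> 'a) topology" where
  "pointwise_topology M d =
     subtopology (product_topology (\<lambda>_. Metric_space.mtopology M d) M) (carrier (ISO M d))"

definition dense_pointwise :: "'a set \<Rightarrow> ('a \<Rightarrow> 'a \<Rightarrow> real) \<Rightarrow> ('a \<Rightarrow> 'a) set \<Rightarrow> bool" where
  "dense_pointwise M d H \<longleftrightarrow> pointwise_topology M d closure_of H = carrier (ISO M d)"

text \<open>Density for pointwise convergence when \<open>M\<close> carries the discrete topology:\<close>

definition dense_pointwise_discrete ::
    "'a set \<Rightarrow> ('a \<Rightarrow> 'a \<Rightarrow> real) \<Rightarrow> ('a \<Rightarrow> 'a) set \<Rightarrow> bool" where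
  "dense_pointwise_discrete M d H \<longleftrightarrow>
     (\<forall>g\<in>carrier (ISO M d). \<forall>E. E \<subseteq> M \<and> finite E \<longrightarrow> (\<exists>h\<in>H. \<forall>x\<in>E. h x = g x))"

definition statement_G :: bool where
  "statement_G \<longleftrightarrow>
     (\<forall>(F :: nat set) r. Metric_space F r \<and> finite F \<longrightarrow>
        (\<exists>(F' :: nat set) r' i T.
           Metric_space F' r' \<and> finite F' \<and>
           isometric_embedding F r F' r' i \<and>
           T \<in> PISO F r \<rightarrow> carrier (ISO F' r') \<and>
           (\<forall>h\<in>PISO F r. \<forall>x\<in>dom h. i (the (h x)) = T h (i x)) \<and>
           (\<forall>K\<subseteq>F. (\<lambda>g. T (as_partial K g)) \<in> hom (ISO K r) (ISO F' r'))))"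

end

theory Submission
  imports Defs
begin

text \<open>
  Call \<open>M\<close> one of the two spaces. The locally finite group is the direct limit of the isometry
  groups of finite sets \<open>F 0 \<subseteq> F 1 \<subseteq> \<dots>\<close> in \<open>M\<close>, along homomorphisms that extend isometries
  of \<open>F n\<close> to isometries of \<open>F (n + 1)\<close>. Such a limit is locally finite, since every finite
  subset of it lies in the image of one of the finite groups.

  Statement (G) yields the tower. To a finite subset \<open>E\<close> of \<open>M\<close> it assigns a finite extension with
  globalizations of all partial isometries of \<open>E\<close>. Universality gives this extension a copy in
  \<open>M\<close>, and homogeneity moves the copy so that it contains \<open>E\<close> itself
  (\<open>globalization_inside\<close>). In this step \<open>E\<close> is taken as \<open>F n\<close> together with the next point of
  a countable set \<open>D\<close>, and \<open>F (n + 1)\<close> as the copy, so that the union of the tower contains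
  \<open>D\<close>. Every finite partial isometry of \<open>D\<close> extends to an element of the limit group
  (\<open>dense_locally_finite_subgroup\<close>), which is the source of density.

  For the rational space \<open>D\<close> is the whole space, and density is immediate. Here the extension
  has to be rational, which (G) does not promise; rounding its distances up to multiples of
  \<open>1 / N\<close>, for a common denominator \<open>N\<close> of the distances of \<open>E\<close>, makes it so
  (\<open>rational_globalization\<close>).

  For the complete space, \<open>D\<close> is dense, and the isometries of the union of the tower extend to
  the completion \<open>M\<close> (\<open>dense_isometry_core\<close>). Density requires that \<open>D\<close> has enough finite
  partial isometries to approximate the isometries of \<open>M\<close>. This is arranged by putting into
  \<open>D\<close> a countable dense set and its images under countably many isometries that are dense for
  pointwise convergence (\<open>countable_dense_isometries\<close>).
\<close>

section \<open>Groups of isometries\<close>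

lemma carrier_ISO [simp]: "carrier (ISO M d) = isometries M d"
  by (simp add: ISO_def)

lemma mult_ISO:
  assumes "f \<in> isometries M d" "g \<in> isometries M d"
  shows "f \<otimes>\<^bsub>ISO M d\<^esub> g = compose M f g"
  using assms by (simp add: ISO_def BijGroup_def isometries_def)

lemma one_ISO: "\<one>\<^bsub>ISO M d\<^esub> = (\<lambda>x\<in>M. x)"
  by (simp add: ISO_def BijGroup_def)

lemma isometriesI:
  assumes "f \<in> extensional M" "bij_betw f M M"
    and "\<And>x y. x \<in> M \<Longrightarrow> y \<in> M \<Longrightarrow> d (f x) (f y) = d x y"
  shows "f \<in> isometries M d"
  using assms by (simp add: isometries_def Bij_def)

lemma isometriesD:
  assumes "f \<in> isometries M d"
  shows "f \<in> extensional M" "bij_betw f M M" "inj_on f M" "f ` M = M"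
    and "\<And>x. x \<in> M \<Longrightarrow> f x \<in> M"
    and "\<And>x y. x \<in> M \<Longrightarrow> y \<in> M \<Longrightarrow> d (f x) (f y) = d x y"
  using assms by (auto simp: isometries_def Bij_def bij_betw_def)

lemma isometries_eqI:
  assumes "f \<in> isometries M d" "g \<in> isometries M d" "\<And>x. x \<in> M \<Longrightarrow> f x = g x"
  shows "f = g"
  using assms by (meson extensionalityI isometriesD(1))

lemma (in Metric_space) isometriesI_surj:
  assumes "K \<subseteq> M" "f \<in> extensional K" "f ` K = K"
    and "\<And>x y. x \<in> K \<Longrightarrow> y \<in> K \<Longrightarrow> d (f x) (f y) = d x y"
  shows "f \<in> isometries K d"
proof (rule isometriesI)
  have "inj_on f K"
  proof (rule inj_onI)
    fix x y assume "x \<in> K" "y \<in> K" "f x = f y"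
    then have "d x y = d (f x) (f x)"
      using assms(4) by metis
    also have "\<dots> = 0"
      using \<open>x \<in> K\<close> assms(1,3) by (metis image_eqI subsetD zero)
    finally show "x = y"
      using \<open>x \<in> K\<close> \<open>y \<in> K\<close> assms(1) by (simp add: subset_iff)
  qed
  then show "bij_betw f K K"
    using assms(3) by (simp add: bij_betw_def)
qed (use assms in auto)

lemma id_isometry: "(\<lambda>x\<in>M. x) \<in> isometries M d"
  by (rule isometriesI) (auto simp: bij_betw_def inj_on_def)

lemma compose_isometry:
  assumes "f \<in> isometries M d" "g \<in> isometries M d"
  shows "compose M f g \<in> isometries M d"
proof (rule isometriesI)
  show "bij_betw (compose M f g) M M"
    using assms by (meson bij_betw_compose isometriesD(2))
qed (use isometriesD(5,6)[OF assms(1)] isometriesD(5,6)[OF assms(2)] in \<open>auto simp: compose_eq\<close>)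

lemma inverse_isometry:
  assumes "f \<in> isometries M d"
  shows "(\<lambda>x\<in>M. inv_into M f x) \<in> isometries M d"
proof (rule isometriesI)
  have bij: "bij_betw (inv_into M f) M M"
    using assms by (simp add: bij_betw_inv_into isometriesD(2))
  then show "bij_betw (\<lambda>x\<in>M. inv_into M f x) M M"
    by (simp cong: bij_betw_cong)
  fix x y assume xy: "x \<in> M" "y \<in> M"
  have mem: "inv_into M f x \<in> M" "inv_into M f y \<in> M"
    using bij xy by (auto simp: bij_betw_def)
  have "d (inv_into M f x) (inv_into M f y) = d (f (inv_into M f x)) (f (inv_into M f y))"
    using isometriesD(6)[OF assms mem] by simp
  also have "\<dots> = d x y"
    using isometriesD(4)[OF assms] xy by (simp add: f_inv_into_f)
  finally show "d ((\<lambda>x\<in>M. inv_into M f x) x) ((\<lambda>x\<in>M. inv_into M f x) y) = d x y"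
    using xy by simp
qed auto

lemma group_ISO: "group (ISO M d)"
proof (rule groupI)
  fix f assume f: "f \<in> carrier (ISO M d)"
  show "\<exists>g\<in>carrier (ISO M d). g \<otimes>\<^bsub>ISO M d\<^esub> f = \<one>\<^bsub>ISO M d\<^esub>"
  proof
    show "(\<lambda>x\<in>M. inv_into M f x) \<in> carrier (ISO M d)"
      using f inverse_isometry by auto
    then show "(\<lambda>x\<in>M. inv_into M f x) \<otimes>\<^bsub>ISO M d\<^esub> f = \<one>\<^bsub>ISO M d\<^esub>"
      using f by (simp add: mult_ISO one_ISO compose_inv_into_id isometriesD(2))
  qed
  have "compose M (\<lambda>x\<in>M. x) f = f"
    using f by (intro Id_compose) (auto dest: isometriesD)
  then show "\<one>\<^bsub>ISO M d\<^esub> \<otimes>\<^bsub>ISO M d\<^esub> f = f"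
    using f by (simp add: one_ISO mult_ISO id_isometry)
next
  fix f g h
  assume fgh: "f \<in> carrier (ISO M d)" "g \<in> carrier (ISO M d)" "h \<in> carrier (ISO M d)"
  then have "h \<in> M \<rightarrow> M"
    by (auto dest: isometriesD)
  then show "f \<otimes>\<^bsub>ISO M d\<^esub> g \<otimes>\<^bsub>ISO M d\<^esub> h = f \<otimes>\<^bsub>ISO M d\<^esub> (g \<otimes>\<^bsub>ISO M d\<^esub> h)"
    using fgh by (simp add: mult_ISO compose_isometry compose_assoc[symmetric])
qed (auto simp: one_ISO mult_ISO id_isometry compose_isometry)

lemma finite_isometries:
  assumes "finite K"
  shows "finite (isometries K d)"
proof (rule finite_subset)
  show "isometries K d \<subseteq> (\<Pi>\<^sub>E x\<in>K. K)"
    by (auto simp: PiE_def dest: isometriesD)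
qed (simp add: assms finite_PiE)

lemma restrict_isometry:
  assumes f: "f \<in> isometries M d" and "K \<subseteq> M" "f ` K = K"
  shows "restrict f K \<in> isometries K d"
proof (rule isometriesI)
  have "inj_on f K"
    using assms(2) isometriesD(3)[OF f] by (rule inj_on_subset[rotated])
  then show "bij_betw (restrict f K) K K"
    using assms(3) by (simp add: bij_betw_def)
  fix x y assume "x \<in> K" "y \<in> K"
  then show "d (restrict f K x) (restrict f K y) = d x y"
    using assms(2) isometriesD(6)[OF f, of x y] by auto
qed auto

text \<open>
  \<open>\<psi>\<close> stands for an inverse of \<open>\<phi>\<close> on \<open>K\<close>. Statement (G) speaks of sets of natural
  numbers, so groups of isometries have to be carried along isometric bijections: once to
  bring a given finite space to the naturals, and once to bring the larger space back.
\<close>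

lemma conjugation_hom:
  assumes "\<And>x. x \<in> K \<Longrightarrow> \<psi> (\<phi> x) = x"
    and "\<And>x y. x \<in> K \<Longrightarrow> y \<in> K \<Longrightarrow> d' (\<phi> x) (\<phi> y) = d x y"
  shows "(\<lambda>g. \<lambda>z\<in>\<phi> ` K. \<phi> (g (\<psi> z))) \<in> hom (ISO K d) (ISO (\<phi> ` K) d')"
proof (rule homI)
  have conj: "(\<lambda>z\<in>\<phi> ` K. \<phi> (g (\<psi> z))) \<in> isometries (\<phi> ` K) d'"
    if g: "g \<in> isometries K d" for g
  proof (rule isometriesI)
    show "bij_betw (\<lambda>z\<in>\<phi> ` K. \<phi> (g (\<psi> z))) (\<phi> ` K) (\<phi> ` K)"
      unfolding bij_betw_def
    proof
      show "inj_on (\<lambda>z\<in>\<phi> ` K. \<phi> (g (\<psi> z))) (\<phi> ` K)"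
      proof (rule inj_onI, clarsimp simp: assms(1))
        fix x y assume xy: "x \<in> K" "y \<in> K" and eq: "\<phi> (g x) = \<phi> (g y)"
        then have "g x = g y"
          by (metis assms(1) g isometriesD(5))
        then show "\<phi> x = \<phi> y"
          using isometriesD(3)[OF g] xy by (auto dest: inj_onD)
      qed
      have "(\<lambda>z\<in>\<phi> ` K. \<phi> (g (\<psi> z))) ` \<phi> ` K = \<phi> ` g ` K"
        by (simp add: image_image assms(1) cong: image_cong_simp)
      then show "(\<lambda>z\<in>\<phi> ` K. \<phi> (g (\<psi> z))) ` \<phi> ` K = \<phi> ` K"
        using isometriesD(4)[OF g] by simp
    qed
  qed (use isometriesD(5,6)[OF g] assms in auto)
  then show "(\<lambda>z\<in>\<phi> ` K. \<phi> (g (\<psi> z))) \<in> carrier (ISO (\<phi> ` K) d')"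
    if "g \<in> carrier (ISO K d)" for g
    using that by simp
  fix g h assume gh: "g \<in> carrier (ISO K d)" "h \<in> carrier (ISO K d)"
  then have "(g \<otimes>\<^bsub>ISO K d\<^esub> h) = compose K g h"
    by (simp add: mult_ISO)
  then show "(\<lambda>z\<in>\<phi> ` K. \<phi> ((g \<otimes>\<^bsub>ISO K d\<^esub> h) (\<psi> z))) =
      (\<lambda>z\<in>\<phi> ` K. \<phi> (g (\<psi> z))) \<otimes>\<^bsub>ISO (\<phi> ` K) d'\<^esub> (\<lambda>z\<in>\<phi> ` K. \<phi> (h (\<psi> z)))"
    using gh isometriesD(5)[of h K d] by (auto simp: mult_ISO conj compose_def assms(1) fun_eq_iff)
qed

lemma as_partial_simps [simp]:
  "dom (as_partial K g) = K"
  "as_partial K g x = (if x \<in> K then Some (g x) else None)"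
  by (auto simp: as_partial_def restrict_map_def dom_def split: if_splits)

lemma as_partial_PISO:
  assumes g: "g \<in> isometries L d" and "E \<subseteq> L" "E \<subseteq> D" "g ` E \<subseteq> D"
  shows "as_partial E g \<in> PISO D d"
proof -
  have E: "x \<in> L" "g x \<in> D" if "x \<in> E" for x
    using that assms(2,4) by auto
  have "inj_on (as_partial E g) E"
    using E(1) isometriesD(3)[OF g] by (auto simp: inj_on_def)
  moreover have "d (g x) (g y) = d x y" if "x \<in> E" "y \<in> E" for x y
    using isometriesD(6)[OF g] that E(1) by simp
  ultimately show ?thesis
    using assms(3) E(2) by (auto simp: PISO_def ran_def split: if_splits)
qed

section \<open>Rational distances\<close>

text \<open>
  A rational finite space may receive irrational distances from statement (G). They are made
  rational by rounding \<^emph>\<open>up\<close> to multiples of \<open>1 / N\<close>. Because the ceiling is monotone,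
  subadditive, and positive at positive arguments, the rounded distance is again a metric; and
  since it is a function of the old one, the old isometries remain isometries. If \<open>N\<close> is a
  common denominator of the distances of the original space, these do not change.
\<close>

definition ceiling_to :: "nat \<Rightarrow> real \<Rightarrow> real" where
  "ceiling_to N t = of_int \<lceil>real N * t\<rceil> / real N"

lemma ceiling_to_Metric_space:
  assumes "Metric_space F r" "N > 0"
  shows "Metric_space F (\<lambda>x y. ceiling_to N (r x y))"
proof -
  interpret Metric_space F r by fact
  show ?thesis
  proof
    show "0 \<le> ceiling_to N (r x y)" for x y
    proof -
      have "0 \<le> real N * r x y"
        by simp
      then have "0 \<le> \<lceil>real N * r x y\<rceil>"
        by linarith
      then show ?thesis
        by (simp add: ceiling_to_def)
    qed
    show "ceiling_to N (r x y) = ceiling_to N (r y x)" for x y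
      by (simp add: commute)
    show "ceiling_to N (r x y) = 0 \<longleftrightarrow> x = y" if "x \<in> F" "y \<in> F" for x y
    proof
      assume "ceiling_to N (r x y) = 0"
      then have "\<lceil>real N * r x y\<rceil> = 0"
        using assms(2) by (simp add: ceiling_to_def)
      then have "real N * r x y \<le> 0"
        by linarith
      then have "r x y = 0"
        using assms(2) nonneg[of x y] by (simp add: mult_le_0_iff)
      then show "x = y"
        using that by simp
    qed (use that in \<open>simp add: ceiling_to_def\<close>)
    show "ceiling_to N (r x z) \<le> ceiling_to N (r x y) + ceiling_to N (r y z)"
      if "x \<in> F" "y \<in> F" "z \<in> F" for x y z
    proof -
      have "real N * r x z \<le> real N * r x y + real N * r y z"
        using triangle[OF that] by (metis distrib_left mult_left_mono of_nat_0_le_iff)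
      then have "\<lceil>real N * r x z\<rceil> \<le> \<lceil>real N * r x y\<rceil> + \<lceil>real N * r y z\<rceil>"
        by linarith
      then have "(of_int \<lceil>real N * r x z\<rceil> :: real) \<le> of_int \<lceil>real N * r x y\<rceil> + of_int \<lceil>real N * r y z\<rceil>"
        by linarith
      then show ?thesis
        by (simp add: ceiling_to_def divide_right_mono flip: add_divide_distrib)
    qed
  qed
qed

lemma common_denominator:
  assumes "finite V" "V \<subseteq> (\<rat> :: real set)"
  shows "\<exists>N>0. \<forall>v\<in>V. real N * v \<in> \<int>"
  using assms
proof (induction rule: finite_induct)
  case (insert v V)
  then obtain N where N: "N > 0" "\<forall>v\<in>V. real N * v \<in> \<int>"
    by auto
  from insert obtain a b :: int where ab: "b > 0" "v = of_int a / of_int b"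
    using Rats_cases' by (metis insert_subset)
  show ?case
  proof (intro exI conjI ballI)
    show "0 < nat b * N"
      using N ab by simp
    fix w assume "w \<in> insert v V"
    then show "real (nat b * N) * w \<in> \<int>"
    proof
      assume "w = v"
      then have "real (nat b * N) * w = of_int (int N * a)"
        using ab by (simp add: of_nat_nat)
      then show ?thesis
        by (metis Ints_of_int)
    next
      assume "w \<in> V"
      then have "of_int b * (real N * w) \<in> \<int>"
        using N by simp
      moreover have "real (nat b * N) * w = of_int b * (real N * w)"
        using ab by simp
      ultimately show ?thesis
        by metis
    qed
  qed
qed (auto intro: exI[of _ 1])

text \<open>
  The converse can fail when \<open>\<phi>\<close> identifies distances: rounding can only enlarge the
  group of isometries, and (G) asks merely for a homomorphism into it.
\<close>

lemma isometries_postcompose: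
  assumes "f \<in> isometries M d"
  shows "f \<in> isometries M (\<lambda>x y. \<phi> (d x y))"
  using assms by (simp add: isometries_def)

lemma mult_ISO_postcompose: "(\<otimes>\<^bsub>ISO M (\<lambda>x y. \<phi> (d x y))\<^esub>) = (\<otimes>\<^bsub>ISO M d\<^esub>)"
  by (simp add: ISO_def)

text \<open>
  What statement (G) provides for one finite space. The carrier types are left free, so that
  the space and its extension may both be subsets of one Urysohn space.
\<close>

definition globalization ::
    "'a set \<Rightarrow> ('a \<Rightarrow> 'a \<Rightarrow> real) \<Rightarrow> 'b set \<Rightarrow> ('b \<Rightarrow> 'b \<Rightarrow> real) \<Rightarrow> ('a \<Rightarrow> 'b) \<Rightarrow>
     (('a \<rightharpoonup> 'a) \<Rightarrow> 'b \<Rightarrow> 'b) \<Rightarrow> bool" where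
  "globalization F r F' r' i T \<longleftrightarrow>
     Metric_space F' r' \<and> finite F' \<and> isometric_embedding F r F' r' i \<and>
     T \<in> PISO F r \<rightarrow> isometries F' r' \<and>
     (\<forall>h\<in>PISO F r. \<forall>x\<in>dom h. i (the (h x)) = T h (i x)) \<and>
     (\<forall>K\<subseteq>F. (\<lambda>g. T (as_partial K g)) \<in> hom (ISO K r) (ISO F' r'))"

lemma globalization_ceiling_to:
  assumes glob: "globalization F r F' r' i T" and N: "N > 0"
    and int: "\<And>x y. x \<in> F \<Longrightarrow> y \<in> F \<Longrightarrow> real N * r x y \<in> \<int>"
  shows "globalization F r F' (\<lambda>x y. ceiling_to N (r' x y)) i T"
proof -
  let ?s = "\<lambda>x y. ceiling_to N (r' x y)"
  have fixes_r: "ceiling_to N (r x y) = r x y" if xy: "x \<in> F" "y \<in> F" for x y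
  proof -
    obtain a where "real N * r x y = of_int a"
      using int[OF xy] by (rule Ints_cases)
    then have "real_of_int \<lceil>real N * r x y\<rceil> = real N * r x y"
      by (metis ceiling_of_int)
    then have "ceiling_to N (r x y) = real N * r x y / real N"
      by (simp only: ceiling_to_def)
    then show ?thesis
      using N by simp
  qed
  have isom: "g \<in> isometries F' ?s" if "g \<in> isometries F' r'" for g
    using that by (rule isometries_postcompose)
  have "isometric_embedding F r F' ?s i"
    using glob fixes_r unfolding globalization_def isometric_embedding_def by metis
  moreover have "T \<in> PISO F r \<rightarrow> isometries F' ?s"
    using glob isom unfolding globalization_def Pi_iff by blast
  moreover have "(\<lambda>g. T (as_partial K g)) \<in> hom (ISO K r) (ISO F' ?s)" if "K \<subseteq> F" for K
  proof -
    have "(\<lambda>g. T (as_partial K g)) \<in> hom (ISO K r) (ISO F' r')"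
      using glob that unfolding globalization_def by blast
    then show ?thesis
      using isom unfolding hom_def Pi_iff mult_ISO_postcompose carrier_ISO by blast
  qed
  moreover have "Metric_space F' ?s"
    using glob N ceiling_to_Metric_space unfolding globalization_def by blast
  ultimately show ?thesis
    using glob unfolding globalization_def by blast
qed

lemma rational_globalization:
  assumes G: "statement_G" and F: "Metric_space F r" "finite (F :: nat set)" "rational_distances F r"
  shows "\<exists>(F' :: nat set) r' i T. rational_distances F' r' \<and> globalization F r F' r' i T"
proof -
  obtain F' :: "nat set" and r' i T where glob: "globalization F r F' r' i T"
    using G F(1,2) unfolding statement_G_def globalization_def carrier_ISO by metis
  have "finite ((\<lambda>(x, y). r x y) ` (F \<times> F))"
    using F by simp
  moreover have "(\<lambda>(x, y). r x y) ` (F \<times> F) \<subseteq> \<rat>"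
    using F by (auto simp: rational_distances_def)
  ultimately obtain N where N: "N > 0" "\<And>x y. x \<in> F \<Longrightarrow> y \<in> F \<Longrightarrow> real N * r x y \<in> \<int>"
    using common_denominator[of "(\<lambda>(x, y). r x y) ` (F \<times> F)"]
    by blast
  have "globalization F r F' (\<lambda>x y. ceiling_to N (r' x y)) i T"
    using globalization_ceiling_to[OF glob N] .
  moreover have "rational_distances F' (\<lambda>x y. ceiling_to N (r' x y))"
    by (simp add: rational_distances_def ceiling_to_def)
  ultimately show ?thesis
    by blast
qed

section \<open>Globalization inside a homogeneous space\<close>

definition conjugate_partial :: "('a \<Rightarrow> 'b) \<Rightarrow> ('b \<Rightarrow> 'a) \<Rightarrow> 'a set \<Rightarrow> ('a \<rightharpoonup> 'a) \<Rightarrow> ('b \<rightharpoonup> 'b)" where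
  "conjugate_partial \<phi> \<psi> E h = (\<lambda>z. if z \<in> \<phi> ` E then map_option \<phi> (h (\<psi> z)) else None)"

text \<open>
  The map \<open>K \<mapsto> \<phi> ` K\<close> turns \<^term>\<open>as_partial K g\<close> into \<open>as_partial (\<phi> ` K)\<close> of the conjugate
  of \<open>g\<close>, so the homomorphism property for \<open>K\<close> is that for \<open>\<phi> ` K\<close> preceded by the
  homomorphism of conjugation.
\<close>

lemma globalization_transport:
  assumes inv: "\<And>x. x \<in> E \<Longrightarrow> \<psi> (\<phi> x) = x"
    and dist: "\<And>x y. x \<in> E \<Longrightarrow> y \<in> E \<Longrightarrow> r (\<phi> x) (\<phi> y) = d x y"
    and glob: "globalization (\<phi> ` E) r F' r' i T"
  shows "globalization E d F' r' (\<lambda>x. i (\<phi> x)) (\<lambda>h. T (conjugate_partial \<phi> \<psi> E h))"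
proof -
  let ?c = "conjugate_partial \<phi> \<psi> E"
  have c_eq: "?c h (\<phi> x) = map_option \<phi> (h x)" if "x \<in> E" for h x
    using that inv by (simp add: conjugate_partial_def)
  have dom_c: "dom (?c h) = \<phi> ` dom h" if h: "h \<in> PISO E d" for h
  proof -
    have "dom h \<subseteq> E"
      using h by (simp add: PISO_def)
    moreover have "z \<in> dom (?c h) \<longleftrightarrow> (\<exists>x\<in>E. z = \<phi> x \<and> x \<in> dom h)" for z
      using inv by (auto simp: conjugate_partial_def dom_def split: if_splits)
    ultimately show ?thesis
      by blast
  qed
  have c: "?c h \<in> PISO (\<phi> ` E) r" if h: "h \<in> PISO E d" for h
  proof -
    have E: "dom h \<subseteq> E" and ranE: "\<And>x. x \<in> dom h \<Longrightarrow> the (h x) \<in> E"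
      and inj: "inj_on h (dom h)"
      and hd: "\<And>x y. x \<in> dom h \<Longrightarrow> y \<in> dom h \<Longrightarrow> d (the (h x)) (the (h y)) = d x y"
      using h by (auto simp: PISO_def ran_def)
    have val: "?c h (\<phi> x) = Some (\<phi> (the (h x)))" if "x \<in> dom h" for x
      using that E c_eq[of x h] by auto
    have "ran (?c h) \<subseteq> \<phi> ` E"
    proof
      fix w assume "w \<in> ran (?c h)"
      then obtain z where "?c h z = Some w"
        by (auto simp: ran_def)
      moreover from this obtain x where "x \<in> dom h" "z = \<phi> x"
        using dom_c[OF h] by blast
      ultimately show "w \<in> \<phi> ` E"
        using val ranE by auto
    qed
    moreover have "inj_on (?c h) (\<phi> ` dom h)"
    proof (rule inj_onI)
      fix z w assume "z \<in> \<phi> ` dom h" "w \<in> \<phi> ` dom h" and eq: "?c h z = ?c h w"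
      then obtain x y where xy: "x \<in> dom h" "y \<in> dom h" "z = \<phi> x" "w = \<phi> y"
        by blast
      then have "\<phi> (the (h x)) = \<phi> (the (h y))"
        using eq val by simp
      then have "the (h x) = the (h y)"
        using inv ranE xy by metis
      then have "h x = h y"
        using xy by auto
      then have "x = y"
        using inj xy by (simp add: inj_on_eq_iff)
      then show "z = w"
        using xy by simp
    qed
    moreover have "r (the (?c h z)) (the (?c h w)) = r z w"
      if zw: "z \<in> \<phi> ` dom h" "w \<in> \<phi> ` dom h" for z w
    proof -
      obtain x y where xy: "x \<in> dom h" "y \<in> dom h" "z = \<phi> x" "w = \<phi> y"
        using zw by blast
      then have "r (the (?c h z)) (the (?c h w)) = d (the (h x)) (the (h y))"
        using val dist ranE by simp
      also have "\<dots> = r z w"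
        using xy hd dist E by (simp add: subset_iff)
      finally show ?thesis .
    qed
    moreover have "\<phi> ` dom h \<subseteq> \<phi> ` E"
      using E by blast
    ultimately show ?thesis
      by (simp add: PISO_def dom_c[OF h])
  qed
  have "isometric_embedding E d F' r' (\<lambda>x. i (\<phi> x))"
    using glob dist by (auto simp: globalization_def isometric_embedding_def)
  moreover have "(\<lambda>h. T (?c h)) \<in> PISO E d \<rightarrow> isometries F' r'"
    using glob c by (auto simp: globalization_def)
  moreover have "i (\<phi> (the (h x))) = T (?c h) (i (\<phi> x))" if h: "h \<in> PISO E d" and x: "x \<in> dom h" for h x
  proof -
    have "\<phi> x \<in> dom (?c h)"
      using dom_c[OF h] x by blast
    then have "i (the (?c h (\<phi> x))) = T (?c h) (i (\<phi> x))"
      using glob c[OF h] unfolding globalization_def by blast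
    moreover have "x \<in> E"
      using h x by (auto simp: PISO_def)
    ultimately show ?thesis
      using x by (auto simp: c_eq)
  qed
  moreover have "(\<lambda>g. T (?c (as_partial K g))) \<in> hom (ISO K d) (ISO F' r')" if K: "K \<subseteq> E" for K
  proof (rule group.hom_eq[OF group_ISO])
    let ?C = "\<lambda>g. \<lambda>z\<in>\<phi> ` K. \<phi> (g (\<psi> z))"
    have "?C \<in> hom (ISO K d) (ISO (\<phi> ` K) r)"
      using K inv dist by (intro conjugation_hom) (auto simp: subset_iff)
    moreover have "(\<lambda>g. T (as_partial (\<phi> ` K) g)) \<in> hom (ISO (\<phi> ` K) r) (ISO F' r')"
      using glob K unfolding globalization_def by blast
    ultimately show "(\<lambda>g. T (as_partial (\<phi> ` K) g)) \<circ> ?C \<in> hom (ISO K d) (ISO F' r')"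
      by (rule hom_compose)
    fix g assume "g \<in> carrier (ISO K d)"
    have "?c (as_partial K g) = as_partial (\<phi> ` K) (?C g)"
    proof
      fix z
      show "?c (as_partial K g) z = as_partial (\<phi> ` K) (?C g) z"
      proof (cases "z \<in> \<phi> ` E")
        case True
        then obtain x where x: "x \<in> E" "z = \<phi> x"
          by blast
        have "\<phi> x \<in> \<phi> ` K \<longleftrightarrow> x \<in> K"
          using x K inv by (metis image_iff subsetD)
        then show ?thesis
          using x inv by (simp add: c_eq)
      next
        case False
        then show ?thesis
          using K by (auto simp: conjugate_partial_def)
      qed
    qed
    then show "T (?c (as_partial K g)) = ((\<lambda>g. T (as_partial (\<phi> ` K) g)) \<circ> ?C) g"
      by simp
  qed
  ultimately show ?thesis
    using glob by (simp add: globalization_def)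
qed

text \<open>
  The predicate \<open>P\<close> carries what else is known of the extension (below: that its distances are
  rational). The third premise of \<open>glob\<close> says that the space over the naturals takes its
  distances from \<open>E\<close>, so it is rational if \<open>E\<close> is.
\<close>

lemma globalization_of_finite_space:
  assumes E: "Metric_space E d" "finite E"
    and glob: "\<And>(F :: nat set) r. Metric_space F r \<Longrightarrow> finite F \<Longrightarrow> (\<forall>x\<in>F. \<forall>y\<in>F. \<exists>u\<in>E. \<exists>v\<in>E. r x y = d u v) \<Longrightarrow>
        \<exists>(F' :: nat set) r' i T. P F' r' \<and> globalization F r F' r' i T"
  shows "\<exists>(F' :: nat set) r' i T. P F' r' \<and> globalization E d F' r' i T"
proof -
  interpret Metric_space E d by fact
  obtain \<phi> where \<phi>: "bij_betw \<phi> E {0..<card E}"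
    using ex_bij_betw_finite_nat[OF E(2)] by blast
  define \<psi> where "\<psi> = inv_into E \<phi>"
  have inv: "\<psi> (\<phi> x) = x" if "x \<in> E" for x
    using \<phi> that by (simp add: \<psi>_def bij_betw_def)
  define r where "r m n = d (\<psi> m) (\<psi> n)" for m n
  have "Metric_space (\<phi> ` E) r"
    by (unfold_locales) (auto simp: r_def inv commute triangle)
  moreover have "\<forall>x\<in>\<phi> ` E. \<forall>y\<in>\<phi> ` E. \<exists>u\<in>E. \<exists>v\<in>E. r x y = d u v"
    using inv by (auto simp: r_def)
  ultimately obtain F' :: "nat set" and r' i T where "P F' r'" "globalization (\<phi> ` E) r F' r' i T"
    using glob[of "\<phi> ` E" r] E(2) by auto
  then show ?thesis
    using globalization_transport[of E \<psi> \<phi> r d F' r' i T] inv r_def by metis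
qed

text \<open>
  The properties common to both Urysohn spaces, once (G) is known: the extension of each
  finite subspace that (G) provides has an isometric copy in the space.
\<close>

locale globalizing_space = Metric_space M d for M :: "'a set" and d +
  assumes homogeneous: "ultrahomogeneous M d"
    and globalization_embeds: "E \<subseteq> M \<Longrightarrow> finite E \<Longrightarrow>
      \<exists>(F' :: nat set) r' i T j. globalization E d F' r' i T \<and> isometric_embedding F' r' M d j"
begin

text \<open>
  The given copy of \<open>F\<close> may put the points of \<open>E\<close> anywhere. Homogeneity supplies an isometry of
  the whole space that moves them back, and this isometry takes the copy along.
\<close>

lemma embedding_extends_identity:
  assumes E: "E \<subseteq> M" "finite E"
    and i: "isometric_embedding E d F r i" and j: "isometric_embedding F r M d j"
  shows "\<exists>J. isometric_embedding F r M d J \<and> (\<forall>x\<in>E. J (i x) = x)"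
proof -
  have jM: "j (i x) \<in> M" and jd: "y \<in> E \<Longrightarrow> d (j (i x)) (j (i y)) = d x y" if "x \<in> E" for x y
    using that i j by (auto simp: isometric_embedding_def Pi_iff)
  have inj: "inj_on (\<lambda>x. j (i x)) E"
  proof (rule inj_onI)
    fix x y assume xy: "x \<in> E" "y \<in> E" "j (i x) = j (i y)"
    then have "d x y = 0"
      using jd[of x y] jM[of x] by simp
    then show "x = y"
      using xy E by (simp add: subset_iff)
  qed
  \<comment> \<open>the partial isometry that undoes \<open>j \<circ> i\<close> on \<open>E\<close>\<close>
  define h where "h y = (if y \<in> (\<lambda>x. j (i x)) ` E then Some (inv_into E (\<lambda>x. j (i x)) y) else None)" for y
  have h: "h (j (i x)) = Some x" if "x \<in> E" for x
    using that inv_into_f_f[OF inj that] by (simp add: h_def)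
  have dom: "dom h = (\<lambda>x. j (i x)) ` E"
    unfolding dom_def h_def by simp
  have "dom h \<subseteq> M"
    unfolding dom using jM by (simp add: image_subset_iff)
  moreover have "ran h \<subseteq> M"
  proof
    fix x assume "x \<in> ran h"
    then obtain y where "h y = Some x"
      by (auto simp: ran_def)
    moreover from this obtain z where "z \<in> E" "y = j (i z)"
      using dom by blast
    ultimately show "x \<in> M"
      using h E by auto
  qed
  moreover have "inj_on h (dom h)"
    unfolding dom by (rule inj_onI) (auto simp: h)
  moreover have "d (the (h y)) (the (h z)) = d y z" if "y \<in> dom h" "z \<in> dom h" for y z
  proof -
    from that obtain u v where "u \<in> E" "v \<in> E" "y = j (i u)" "z = j (i v)"
      using dom by blast
    then show ?thesis
      by (simp add: h jd)
  qed
  ultimately have "h \<in> PISO M d"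
    by (simp add: PISO_def)
  then obtain g where g: "g \<in> isometries M d" "\<forall>y\<in>dom h. h y = Some (g y)"
    using homogeneous E(2) dom unfolding ultrahomogeneous_def carrier_ISO by (metis finite_imageI)
  have "isometric_embedding F r M d (\<lambda>z. g (j z))"
    using j isometriesD(5,6)[OF g(1)] by (simp add: isometric_embedding_def Pi_iff)
  moreover have "g (j (i x)) = x" if "x \<in> E" for x
  proof -
    have "j (i x) \<in> dom h"
      unfolding dom using that by (rule imageI)
    then have "h (j (i x)) = Some (g (j (i x)))"
      using g(2) by blast
    then show ?thesis
      using h[OF that] by simp
  qed
  ultimately show ?thesis
    by blast
qed

lemma globalization_inside:
  assumes E: "E \<subseteq> M" "finite E"
  shows "\<exists>F T. E \<subseteq> F \<and> F \<subseteq> M \<and> globalization E d F d (\<lambda>x. x) T"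
proof -
  obtain F' :: "nat set" and r' i T j
    where glob: "globalization E d F' r' i T" and j: "isometric_embedding F' r' M d j"
    using globalization_embeds[OF E] by blast
  interpret F': Metric_space F' r'
    using glob by (simp add: globalization_def)
  have i: "isometric_embedding E d F' r' i"
    using glob by (simp add: globalization_def)
  obtain J where J: "isometric_embedding F' r' M d J" "\<And>x. x \<in> E \<Longrightarrow> J (i x) = x"
    using embedding_extends_identity[OF E i j] by blast
  have JM: "\<And>x. x \<in> F' \<Longrightarrow> J x \<in> M"
    and Jd: "\<And>x y. x \<in> F' \<Longrightarrow> y \<in> F' \<Longrightarrow> d (J x) (J y) = r' x y"
    and iF': "\<And>x. x \<in> E \<Longrightarrow> i x \<in> F'"
    using J(1) i by (auto simp: isometric_embedding_def)
  define \<psi> where "\<psi> = inv_into F' J"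
  have "inj_on J F'"
  proof (rule inj_onI)
    fix x y assume xy: "x \<in> F'" "y \<in> F'" "J x = J y"
    then have "r' x y = 0"
      using Jd[of x y] JM[of x] by simp
    then show "x = y"
      using xy by simp
  qed
  then have \<psi>: "\<psi> (J x) = x" if "x \<in> F'" for x
    using that by (simp add: \<psi>_def)
  let ?C = "\<lambda>g. \<lambda>z\<in>J ` F'. J (g (\<psi> z))"
  have C: "?C \<in> hom (ISO F' r') (ISO (J ` F') d)"
    using \<psi> Jd by (rule conjugation_hom)
  have sub: "J ` F' \<subseteq> M" "E \<subseteq> J ` F'"
    using JM iF' J(2) by (blast, metis image_eqI subsetI)
  have "globalization E d (J ` F') d (\<lambda>x. x) (\<lambda>h. ?C (T h))"
    unfolding globalization_def
  proof (intro conjI ballI allI impI)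
    show "Metric_space (J ` F') d"
      using sub by (simp add: subspace)
    show "finite (J ` F')"
      using glob by (simp add: globalization_def)
    show "isometric_embedding E d (J ` F') d (\<lambda>x. x)"
      using sub by (auto simp: isometric_embedding_def)
    have "?C g \<in> isometries (J ` F') d" if "g \<in> isometries F' r'" for g
      using hom_in_carrier[OF C] that by simp
    then show "(\<lambda>h. ?C (T h)) \<in> PISO E d \<rightarrow> isometries (J ` F') d"
      using glob by (auto simp: globalization_def)
    show "the (h x) = ?C (T h) x" if h: "h \<in> PISO E d" and x: "x \<in> dom h" for h x
    proof -
      have xE: "x \<in> E" "the (h x) \<in> E"
        using h x by (auto simp: PISO_def ran_def)
      then have "?C (T h) x = J (T h (\<psi> (J (i x))))"
        using sub J(2) by (simp add: subset_iff)
      also have "\<dots> = J (T h (i x))"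
        using xE iF' \<psi> by simp
      also have "T h (i x) = i (the (h x))"
        using glob h x by (simp add: globalization_def)
      finally show ?thesis
        using xE J(2) by simp
    qed
    show "(\<lambda>g. ?C (T (as_partial K g))) \<in> hom (ISO K d) (ISO (J ` F') d)" if "K \<subseteq> E" for K
    proof -
      have "(\<lambda>g. T (as_partial K g)) \<in> hom (ISO K d) (ISO F' r')"
        using glob that by (simp add: globalization_def)
      from hom_compose[OF this C] show ?thesis
        by (simp add: comp_def)
    qed
  qed
  with sub show ?thesis
    by blast
qed

end

section \<open>Towers of finite sets with compatible homomorphisms\<close>

text \<open>
  \<open>X\<close> is so large that isometries of \<open>M\<close> may be defined, and compared, on \<open>X\<close>. There are two
  examples: \<open>X = M\<close>, and a dense subset of a complete space. They allow one construction to
  serve for both Urysohn spaces.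
\<close>

definition isometry_core :: "'a set \<Rightarrow> ('a \<Rightarrow> 'a \<Rightarrow> real) \<Rightarrow> 'a set \<Rightarrow> bool" where
  "isometry_core M d X \<longleftrightarrow> X \<subseteq> M \<and>
     (\<forall>f\<in>isometries X d. \<exists>g\<in>isometries M d. \<forall>x\<in>X. g x = f x) \<and>
     (\<forall>f\<in>isometries M d. \<forall>g\<in>isometries M d. (\<forall>x\<in>X. f x = g x) \<longrightarrow> f = g)"

lemma isometry_coreD:
  assumes "isometry_core M d X"
  shows "f \<in> isometries X d \<Longrightarrow> \<exists>g\<in>isometries M d. \<forall>x\<in>X. g x = f x"
    and "f \<in> isometries M d \<Longrightarrow> g \<in> isometries M d \<Longrightarrow> (\<And>x. x \<in> X \<Longrightarrow> f x = g x) \<Longrightarrow> f = g"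
  using assms by (simp_all add: isometry_core_def)

lemma isometry_core_self: "isometry_core M d M"
  unfolding isometry_core_def
proof (intro conjI ballI impI)
  show "\<exists>g\<in>isometries M d. \<forall>x\<in>M. g x = f x" if "f \<in> isometries M d" for f
    using that by (intro bexI[of _ f]) auto
  show "f = g" if "f \<in> isometries M d" "g \<in> isometries M d" "\<forall>x\<in>M. f x = g x" for f g
    using isometries_eqI[OF that(1,2)] that(3) by simp
qed simp

lemma finite_subset_incseq_UN:
  assumes "incseq A" "finite S" "S \<subseteq> (\<Union>n. A n)"
  shows "\<exists>n. S \<subseteq> A n"
  using assms(2,3)
proof (induction rule: finite_induct)
  case (insert x S)
  then obtain m n where "S \<subseteq> A m" "x \<in> A n"
    by auto
  moreover have "A m \<subseteq> A (max m n)" "A n \<subseteq> A (max m n)"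
    using assms(1) by (simp_all add: incseqD)
  ultimately show ?case
    by blast
qed simp

text \<open>
  The finite groups \<open>ISO (F n)\<close> form a direct system under \<open>\<tau>\<close>. Each \<open>\<tau> n\<close> extends isometries, so
  an isometry \<open>g\<close> of \<open>F n\<close> defines an isometry of the union \<open>\<Union>n. F n\<close>, and thus one of \<open>M\<close>. The
  direct limit of the system becomes a group of isometries of \<open>M\<close> in this way.
\<close>

locale isometry_tower = Metric_space M d for M :: "'a set" and d +
  fixes F :: "nat \<Rightarrow> 'a set" and \<tau> :: "nat \<Rightarrow> ('a \<Rightarrow> 'a) \<Rightarrow> 'a \<Rightarrow> 'a"
  assumes F_subset: "F n \<subseteq> M"
    and F_finite: "finite (F n)"
    and F_Suc: "F n \<subseteq> F (Suc n)"
    and \<tau>_hom: "\<tau> n \<in> hom (ISO (F n) d) (ISO (F (Suc n)) d)"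
    and \<tau>_extends: "g \<in> isometries (F n) d \<Longrightarrow> x \<in> F n \<Longrightarrow> \<tau> n g x = g x"
    and core: "isometry_core M d (\<Union>n. F n)"
begin

lemma F_mono: "m \<le> n \<Longrightarrow> F m \<subseteq> F n"
  using F_Suc by (rule lift_Suc_mono_le)

lemma incseq_F: "incseq F"
  using F_mono by (simp add: incseq_def)

lemma \<tau>_isometry: "g \<in> isometries (F n) d \<Longrightarrow> \<tau> n g \<in> isometries (F (Suc n)) d"
  using hom_in_carrier[OF \<tau>_hom] by simp

text \<open>
  The image of \<open>ISO (F n)\<close> in the direct limit, described by what its elements satisfy: from
  level \<open>n\<close> on, \<open>\<tau>\<close> dictates how the isometry continues. With this description, closure under the
  group operations follows because the \<open>\<tau> m\<close> are homomorphisms, and only the existence of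
  elements (\<open>stage_extends\<close> below) needs a limit.
\<close>

definition stage :: "nat \<Rightarrow> ('a \<Rightarrow> 'a) set" where
  "stage n = {f \<in> isometries M d. \<forall>m\<ge>n. f ` F m = F m \<and>
     restrict f (F (Suc m)) = \<tau> m (restrict f (F m))}"

lemma stageD:
  assumes "f \<in> stage n"
  shows "f \<in> isometries M d"
    and "n \<le> m \<Longrightarrow> f ` F m = F m"
    and "n \<le> m \<Longrightarrow> restrict f (F (Suc m)) = \<tau> m (restrict f (F m))"
    and "n \<le> m \<Longrightarrow> restrict f (F m) \<in> isometries (F m) d"
  using assms F_subset restrict_isometry[of f M d "F m"] by (auto simp: stage_def)

lemma incseq_stage: "incseq stage"
  by (rule incseq_SucI) (simp add: stage_def subset_iff)

lemma stage_eqI: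
  assumes f: "f \<in> stage n" and g: "g \<in> stage n" and eq: "restrict f (F n) = restrict g (F n)"
  shows "f = g"
proof -
  have "restrict f (F m) = restrict g (F m)" if "n \<le> m" for m
    using that
  proof (induction rule: dec_induct)
    case (step m)
    then show ?case
      using stageD(3)[OF f] stageD(3)[OF g] by metis
  qed (rule eq)
  moreover have "x \<in> F (max m n)" if "x \<in> F m" for x m
    using that F_mono[of m "max m n"] by auto
  ultimately have "f x = g x" if "x \<in> F m" for x m
    using that by (metis max.cobounded2 restrict_apply')
  then show ?thesis
    by (intro isometry_coreD(2)[OF core stageD(1)[OF f] stageD(1)[OF g]]) auto
qed

text \<open>
  An element of \<open>stage n\<close> is determined by its restriction to \<open>F n\<close>, for which there are finitely
  many choices.
\<close>

lemma finite_stage: "finite (stage n)"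
proof (rule finite_imageD)
  show "finite ((\<lambda>f. restrict f (F n)) ` stage n)"
  proof (rule finite_subset)
    show "(\<lambda>f. restrict f (F n)) ` stage n \<subseteq> isometries (F n) d"
      using stageD(4) by blast
  qed (simp add: F_finite finite_isometries)
  show "inj_on (\<lambda>f. restrict f (F n)) (stage n)"
    using stage_eqI by (rule inj_onI)
qed

lemma restrict_compose_level:
  assumes "f \<in> isometries M d" "g \<in> isometries M d" "f ` F m = F m" "g ` F m = F m"
  shows "restrict (compose M f g) (F m) = restrict f (F m) \<otimes>\<^bsub>ISO (F m) d\<^esub> restrict g (F m)"
proof -
  have "restrict (compose M f g) (F m) = compose (F m) (restrict f (F m)) (restrict g (F m))"
    using F_subset[of m] assms(4) by (auto simp: compose_def fun_eq_iff)
  then show ?thesis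
    using assms F_subset by (simp add: mult_ISO restrict_isometry)
qed

lemma stage_compose:
  assumes f: "f \<in> stage n" and g: "g \<in> stage n"
  shows "compose M f g \<in> stage n"
  unfolding stage_def
proof (intro CollectI conjI allI impI)
  show "compose M f g \<in> isometries M d"
    using f g by (simp add: compose_isometry stageD)
  fix m assume m: "n \<le> m"
  have im: "f ` F k = F k" "g ` F k = F k" if "n \<le> k" for k
    using stageD(2)[OF f that] stageD(2)[OF g that] by auto
  have "compose M f g ` F m = f ` g ` F m"
    using F_subset[of m] by (simp add: compose_def image_image subset_iff cong: image_cong)
  then show "compose M f g ` F m = F m"
    using im m by simp
  have "restrict (compose M f g) (F (Suc m)) =
      \<tau> m (restrict f (F m)) \<otimes>\<^bsub>ISO (F (Suc m)) d\<^esub> \<tau> m (restrict g (F m))"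
    using restrict_compose_level[of f g "Suc m"] f g im m by (simp add: stageD)
  also have "\<dots> = \<tau> m (restrict f (F m) \<otimes>\<^bsub>ISO (F m) d\<^esub> restrict g (F m))"
    using hom_mult[OF \<tau>_hom] stageD(4)[OF f m] stageD(4)[OF g m] by simp
  also have "\<dots> = \<tau> m (restrict (compose M f g) (F m))"
    using restrict_compose_level[of f g m] f g im m by (simp add: stageD)
  finally show "restrict (compose M f g) (F (Suc m)) = \<tau> m (restrict (compose M f g) (F m))" .
qed

lemma subgroup_stage: "subgroup (stage n) (ISO M d)"
proof -
  interpret G: group "ISO M d"
    by (rule group_ISO)
  have id: "(\<lambda>x\<in>M. x) \<in> stage n"
    unfolding stage_def
  proof (intro CollectI conjI allI impI)
    fix m
    have res: "restrict (\<lambda>x\<in>M. x) (F k) = \<one>\<^bsub>ISO (F k) d\<^esub>" for k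
      using F_subset[of k] by (auto simp: one_ISO fun_eq_iff)
    show "(\<lambda>x\<in>M. x) ` F m = F m"
      using F_subset[of m] by (auto simp: subset_iff)
    show "restrict (\<lambda>x\<in>M. x) (F (Suc m)) = \<tau> m (restrict (\<lambda>x\<in>M. x) (F m))"
      using hom_one[OF \<tau>_hom group_ISO group_ISO] by (simp only: res)
  qed (rule id_isometry)
  show ?thesis
  proof (rule G.subgroupI)
    show "stage n \<subseteq> carrier (ISO M d)"
      by (auto simp: stageD)
    show "stage n \<noteq> {}"
      using id by blast
    show "f \<otimes>\<^bsub>ISO M d\<^esub> g \<in> stage n" if "f \<in> stage n" "g \<in> stage n" for f g
      using that by (simp add: mult_ISO stageD stage_compose)
    fix f assume f: "f \<in> stage n"
    let ?f' = "inv\<^bsub>ISO M d\<^esub> f"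
    have fM: "f \<in> isometries M d" and f'M: "?f' \<in> isometries M d"
      using f G.inv_closed by (auto simp: stageD)
    have "compose M ?f' f = (\<lambda>x\<in>M. x)"
      using G.l_inv[of f] fM by (simp only: carrier_ISO mult_ISO[OF f'M fM] one_ISO)
    then have cancel: "?f' (f x) = x" if "x \<in> M" for x
      using that by (metis compose_eq restrict_apply')
    have im: "?f' ` F m = F m" if "n \<le> m" for m
    proof -
      have "?f' ` f ` F m = F m"
        using F_subset[of m] cancel by (simp add: image_image subset_iff cong: image_cong)
      then show ?thesis
        using stageD(2)[OF f that] by simp
    qed
    have res_inv: "restrict ?f' (F m) = inv\<^bsub>ISO (F m) d\<^esub> (restrict f (F m))" if m: "n \<le> m" for m
    proof (rule group.inv_equality[OF group_ISO, symmetric])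
      have "restrict ?f' (F m) \<otimes>\<^bsub>ISO (F m) d\<^esub> restrict f (F m) = restrict (compose M ?f' f) (F m)"
        using restrict_compose_level[OF f'M fM im[OF m] stageD(2)[OF f m]] by simp
      also have "\<dots> = \<one>\<^bsub>ISO (F m) d\<^esub>"
        using F_subset[of m] cancel by (auto simp: one_ISO fun_eq_iff compose_def)
      finally show "restrict ?f' (F m) \<otimes>\<^bsub>ISO (F m) d\<^esub> restrict f (F m) = \<one>\<^bsub>ISO (F m) d\<^esub>" .
      show "restrict f (F m) \<in> carrier (ISO (F m) d)"
        using stageD(4)[OF f m] by simp
      show "restrict ?f' (F m) \<in> carrier (ISO (F m) d)"
        using restrict_isometry[OF f'M F_subset im[OF m]] by simp
    qed
    show "?f' \<in> stage n"
      unfolding stage_def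
    proof (intro CollectI conjI allI impI)
      fix m assume m: "n \<le> m"
      show "?f' ` F m = F m"
        using im m .
      interpret \<tau>: group_hom "ISO (F m) d" "ISO (F (Suc m)) d" "\<tau> m"
        by (simp add: group_hom_def group_hom_axioms_def group_ISO \<tau>_hom)
      show "restrict ?f' (F (Suc m)) = \<tau> m (restrict ?f' (F m))"
        using res_inv[of m] res_inv[of "Suc m"] stageD(3,4)[OF f m] m by simp
    qed (rule f'M)
  qed
qed

lemma stage_extends:
  assumes g: "g \<in> isometries (F n) d"
  shows "\<exists>f\<in>stage n. \<forall>x\<in>F n. f x = g x"
proof -
  \<comment> \<open>\<open>L k\<close> is the continuation of \<open>g\<close> to \<open>F (n + k)\<close>; these functions agree where they meet\<close>
  define L where "L = rec_nat g (\<lambda>k. \<tau> (n + k))"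
  have L_simps: "L 0 = g" "L (Suc k) = \<tau> (n + k) (L k)" for k
    by (simp_all add: L_def)
  have L: "L k \<in> isometries (F (n + k)) d" for k
    by (induction k) (use g \<tau>_isometry in \<open>auto simp: L_simps\<close>)
  have L_stable: "L (k + j) x = L k x" if x: "x \<in> F (n + k)" for k j x
  proof (induction j)
    case (Suc j)
    have "x \<in> F (n + (k + j))"
      using x F_mono[of "n + k" "n + (k + j)"] by auto
    then have "L (Suc (k + j)) x = L (k + j) x"
      using \<tau>_extends[OF L] by (simp add: L_simps)
    then show ?case
      using Suc by simp
  qed simp
  define X where "X = (\<Union>n. F n)"
  have X: "\<exists>k. x \<in> F (n + k)" if "x \<in> X" for x
  proof -
    obtain m where "x \<in> F m"
      using \<open>x \<in> X\<close> by (auto simp: X_def)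
    then have "x \<in> F (n + m)"
      using F_mono[of m "n + m"] by auto
    then show ?thesis ..
  qed
  define f where "f = (\<lambda>x\<in>X. L (LEAST k. x \<in> F (n + k)) x)"
  have f_eq: "f x = L k x" if x: "x \<in> F (n + k)" for x k
  proof -
    let ?l = "LEAST k. x \<in> F (n + k)"
    have "x \<in> F (n + ?l)" "?l \<le> k"
      using x by (auto intro: LeastI Least_le)
    then have "L k x = L ?l x"
      using L_stable[of x ?l "k - ?l"] by simp
    then show ?thesis
      using x by (auto simp: f_def X_def)
  qed
  have XM: "X \<subseteq> M"
    using F_subset by (auto simp: X_def)
  have "f \<in> isometries X d"
  proof (rule isometriesI_surj[OF XM])
    show "f \<in> extensional X"
      by (simp add: f_def)
    have "f ` F (n + k) = F (n + k)" for k
      using isometriesD(4)[OF L[of k]] f_eq by (simp cong: image_cong)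
    moreover have "X = (\<Union>k. F (n + k))"
      using X by (auto simp: X_def)
    ultimately show "f ` X = X"
      by (simp add: image_UN)
    fix x y assume "x \<in> X" "y \<in> X"
    then obtain k l where "x \<in> F (n + k)" "y \<in> F (n + l)"
      using X by blast
    then have xy: "x \<in> F (n + (k + l))" "y \<in> F (n + (k + l))"
      using F_mono[of "n + k" "n + (k + l)"] F_mono[of "n + l" "n + (k + l)"] by auto
    then show "d (f x) (f y) = d x y"
      using isometriesD(6)[OF L xy] f_eq[OF xy(1)] f_eq[OF xy(2)] by simp
  qed
  then obtain f' where f': "f' \<in> isometries M d" "\<And>x. x \<in> X \<Longrightarrow> f' x = f x"
    using isometry_coreD(1)[OF core, of f] unfolding X_def by auto
  have f'_eq: "f' x = L k x" if "x \<in> F (n + k)" for x k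
    using that f_eq[OF that] f'(2)[of x] by (auto simp: X_def)
  have res: "restrict f' (F (n + k)) = L k" for k
    using isometriesD(1)[OF L[of k]] f'_eq by (auto simp: fun_eq_iff extensional_def)
  have "f' \<in> stage n"
    unfolding stage_def
  proof (intro CollectI conjI allI impI)
    fix m assume "n \<le> m"
    then obtain k where m: "m = n + k"
      using le_Suc_ex by blast
    show "f' ` F m = F m"
      using isometriesD(4)[OF L[of k]] f'_eq by (simp add: m cong: image_cong)
    show "restrict f' (F (Suc m)) = \<tau> m (restrict f' (F m))"
      using res[of k] res[of "Suc k"] by (simp add: m L_simps)
  qed (rule f'(1))
  moreover have "f' x = g x" if "x \<in> F n" for x
    using f'_eq[of x 0] that by (simp add: L_simps)
  ultimately show ?thesis
    by blast
qed

definition limit_group :: "('a \<Rightarrow> 'a) set" where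
  "limit_group = (\<Union>n. stage n)"

lemma subgroup_limit_group: "subgroup limit_group (ISO M d)"
proof -
  interpret G: group "ISO M d"
    by (rule group_ISO)
  show ?thesis
  proof (rule G.subgroupI)
    show "limit_group \<subseteq> carrier (ISO M d)"
      by (auto simp: limit_group_def stageD)
    show "limit_group \<noteq> {}"
      using subgroup.one_closed[OF subgroup_stage] by (auto simp: limit_group_def)
    show "inv\<^bsub>ISO M d\<^esub> f \<in> limit_group" if "f \<in> limit_group" for f
      using that subgroup.m_inv_closed[OF subgroup_stage] by (auto simp: limit_group_def)
    fix f g assume "f \<in> limit_group" "g \<in> limit_group"
    then obtain n where "{f, g} \<subseteq> stage n"
      using finite_subset_incseq_UN[OF incseq_stage, of "{f, g}"] by (auto simp: limit_group_def)
    then show "f \<otimes>\<^bsub>ISO M d\<^esub> g \<in> limit_group"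
      using subgroup.m_closed[OF subgroup_stage] by (auto simp: limit_group_def)
  qed
qed

text \<open>
  Finitely many elements lie in a common \<open>stage n\<close>, which is a finite subgroup.
\<close>

lemma locally_finite_limit_group: "locally_finite_group (ISO M d \<lparr>carrier := limit_group\<rparr>)"
  unfolding locally_finite_group_def
proof (intro conjI allI impI)
  let ?H = "ISO M d \<lparr>carrier := limit_group\<rparr>"
  show H: "group ?H"
    using subgroup.subgroup_is_group[OF subgroup_limit_group group_ISO] .
  fix A assume "A \<subseteq> carrier ?H \<and> finite A"
  then obtain n where A: "A \<subseteq> stage n"
    using finite_subset_incseq_UN[OF incseq_stage, of A] by (auto simp: limit_group_def)
  have "subgroup (stage n) ?H"
    using group.subgroup_incl[OF group_ISO subgroup_stage subgroup_limit_group, of n]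
    by (auto simp: limit_group_def)
  then have "generate ?H A \<subseteq> stage n"
    using group.generate_subgroup_incl[OF H A] by blast
  then show "finite (generate ?H A)"
    using finite_stage finite_subset by blast
qed

end

context globalizing_space
begin

text \<open>
  \<open>F (n + 1)\<close> is an extension, as in (G), of \<open>E n = F n \<union> {q}\<close>, where \<open>q\<close> is the \<open>n\<close>-th point of
  \<open>D\<close>. The homomorphism \<open>\<tau> n\<close> has to start at \<open>ISO (F n)\<close>, while the isometries of \<open>F n\<close> are only
  partial ones of \<open>E n\<close>: this is why (G) asks for homomorphisms on \<open>ISO K\<close> for all subsets \<open>K\<close>
  and not just for the whole space. A finite partial isometry of \<open>D\<close> lives in some \<open>E n\<close>, hence
  extends to an isometry of \<open>F (n + 1)\<close>, hence to an element of the limit group.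
\<close>

lemma dense_locally_finite_subgroup:
  assumes D: "countable D" "D \<subseteq> M"
    and core: "\<And>X. D \<subseteq> X \<Longrightarrow> X \<subseteq> M \<Longrightarrow> isometry_core M d X"
  shows "\<exists>H. subgroup H (ISO M d) \<and> locally_finite_group (ISO M d \<lparr>carrier := H\<rparr>) \<and>
    (\<forall>h\<in>PISO D d. finite (dom h) \<longrightarrow> (\<exists>f\<in>H. \<forall>x\<in>dom h. h x = Some (f x)))"
proof -
  have "\<forall>E\<in>{E. E \<subseteq> M \<and> finite E}. \<exists>p. E \<subseteq> fst p \<and> fst p \<subseteq> M \<and>
      globalization E d (fst p) d (\<lambda>x. x) (snd p)"
    using globalization_inside by auto
  then obtain N where "\<forall>E\<in>{E. E \<subseteq> M \<and> finite E}. E \<subseteq> fst (N E) \<and> fst (N E) \<subseteq> M \<and>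
      globalization E d (fst (N E)) d (\<lambda>x. x) (snd (N E))"
    unfolding bchoice_iff ..
  then have N: "E \<subseteq> fst (N E) \<and> fst (N E) \<subseteq> M \<and>
      globalization E d (fst (N E)) d (\<lambda>x. x) (snd (N E))" if "E \<subseteq> M" "finite E" for E
    using that by simp
  define q where "q n = (if D = {} then {} else {from_nat_into D n})" for n
  have q: "q n \<subseteq> M" "finite (q n)" for n
    using D(2) from_nat_into[of D n] by (auto simp: q_def)
  have "D \<subseteq> (\<Union>n. q n)"
    using D(1) from_nat_into_surj[OF D(1)] by (force simp: q_def)
  define F where "F = rec_nat {} (\<lambda>n X. fst (N (X \<union> q n)))"
  have F_0: "F 0 = {}" and F_Suc: "F (Suc n) = fst (N (F n \<union> q n))" for n
    by (simp_all add: F_def)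
  have F: "F n \<subseteq> M \<and> finite (F n)" for n
  proof (induction n)
    case (Suc n)
    then show ?case
      using N[of "F n \<union> q n"] q[of n] by (auto simp: F_Suc globalization_def)
  qed (simp add: F_0)
  define E where "E n = F n \<union> q n" for n
  define T where "T n = snd (N (E n))" for n
  have step: "E n \<subseteq> F (Suc n)" "globalization (E n) d (F (Suc n)) d (\<lambda>x. x) (T n)" for n
    using N[of "E n"] F[of n] q[of n] by (auto simp: F_Suc E_def T_def)
  have T: "T n h \<in> isometries (F (Suc n)) d" "\<And>x. x \<in> dom h \<Longrightarrow> T n h x = the (h x)"
    if "h \<in> PISO (E n) d" for n h
    using step(2)[of n] that by (auto simp: globalization_def)
  define \<tau> where "\<tau> n g = T n (as_partial (F n) g)" for n g
  have D_F: "D \<subseteq> (\<Union>n. F n)"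
    using \<open>D \<subseteq> (\<Union>n. q n)\<close> step(1) by (fastforce simp: E_def)
  interpret isometry_tower M d F \<tau>
  proof
    show "F n \<subseteq> M" "finite (F n)" for n
      using F by auto
    show "F n \<subseteq> F (Suc n)" for n
      using step(1) by (auto simp: E_def)
    show "\<tau> n \<in> hom (ISO (F n) d) (ISO (F (Suc n)) d)" for n
      using step(2)[of n] by (auto simp: globalization_def \<tau>_def[abs_def] E_def)
    show "\<tau> n g x = g x" if g: "g \<in> isometries (F n) d" and x: "x \<in> F n" for n g x
    proof -
      have "as_partial (F n) g \<in> PISO (E n) d"
        using isometriesD(4)[OF g] by (intro as_partial_PISO[OF g]) (auto simp: E_def)
      from T(2)[OF this, of x] show ?thesis
        using x by (simp add: \<tau>_def)
    qed
    show "isometry_core M d (\<Union>n. F n)"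
      using core[OF D_F] F by blast
  qed
  have "\<exists>f\<in>limit_group. \<forall>x\<in>dom h. h x = Some (f x)"
    if h: "h \<in> PISO D d" and fin: "finite (dom h)" for h
  proof -
    have "finite (ran h)"
      using fin by (simp add: finite_ran)
    moreover have "dom h \<union> ran h \<subseteq> (\<Union>n. F n)"
      using h D_F by (auto simp: PISO_def)
    ultimately obtain n where "dom h \<union> ran h \<subseteq> F n"
      using finite_subset_incseq_UN[OF incseq_F, of "dom h \<union> ran h"] fin by auto
    then have h': "h \<in> PISO (E n) d"
      using h by (auto simp: PISO_def E_def)
    obtain f where "f \<in> stage (Suc n)" "\<And>x. x \<in> F (Suc n) \<Longrightarrow> f x = T n h x"
      using stage_extends[OF T(1)[OF h']] by blast
    moreover have "x \<in> F (Suc n)" if "x \<in> dom h" for x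
      using that h' step(1) by (auto simp: PISO_def)
    ultimately show ?thesis
      using T(2)[OF h'] by (force simp: limit_group_def)
  qed
  then show ?thesis
    using subgroup_limit_group locally_finite_limit_group by blast
qed

end

section \<open>The rational Urysohn space\<close>

lemma rational_Urysohn_globalizing_space:
  assumes G: "statement_G" and Q: "rational_Urysohn_space Q d"
  shows "globalizing_space Q d"
proof -
  interpret Metric_space Q d
    using Q by (simp add: rational_Urysohn_space_def)
  show ?thesis
  proof
    show "ultrahomogeneous Q d"
      using Q by (simp add: rational_Urysohn_space_def)
    fix E assume E: "E \<subseteq> Q" "finite E"
    have rat: "d u v \<in> \<rat>" if "u \<in> E" "v \<in> E" for u v
      using Q E(1) that unfolding rational_Urysohn_space_def rational_distances_def
      by (meson subsetD)
    have "\<exists>(F' :: nat set) r' i T. rational_distances F' r' \<and> globalization E d F' r' i T"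
    proof (rule globalization_of_finite_space)
      show "Metric_space E d"
        using E by (simp add: subspace)
      show "\<exists>(F' :: nat set) r' i T. rational_distances F' r' \<and> globalization F r F' r' i T"
        if F: "Metric_space F r" "finite F" "\<forall>x\<in>F. \<forall>y\<in>F. \<exists>u\<in>E. \<exists>v\<in>E. r x y = d u v"
        for F :: "nat set" and r
      proof (rule rational_globalization[OF G F(1,2)])
        show "rational_distances F r"
          unfolding rational_distances_def using F(3) rat by metis
      qed
    qed (rule E)
    then obtain F' :: "nat set" and r' i T
      where F': "rational_distances F' r'" "globalization E d F' r' i T"
      by blast
    then have "Metric_space F' r'" "finite F'"
      by (simp_all add: globalization_def)
    then obtain j where "isometric_embedding F' r' Q d j"
      using Q F'(1) unfolding rational_Urysohn_space_def by blast
    with F'(2) show "\<exists>(F' :: nat set) r' i T j.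
        globalization E d F' r' i T \<and> isometric_embedding F' r' Q d j"
      by blast
  qed
qed

lemma dense_locally_finite_rational_Urysohn:
  assumes G: "statement_G" and Q: "rational_Urysohn_space Q d"
  shows "\<exists>H. subgroup H (ISO Q d) \<and> locally_finite_group (ISO Q d \<lparr>carrier := H\<rparr>) \<and>
    dense_pointwise_discrete Q d H"
proof -
  interpret globalizing_space Q d
    using assms by (rule rational_Urysohn_globalizing_space)
  have "isometry_core Q d X" if "Q \<subseteq> X" "X \<subseteq> Q" for X
    using that isometry_core_self by (metis subset_antisym)
  moreover have "countable Q"
    using Q by (simp add: rational_Urysohn_space_def)
  ultimately obtain H where H: "subgroup H (ISO Q d)"
      "locally_finite_group (ISO Q d \<lparr>carrier := H\<rparr>)"
    and ext: "\<And>h. h \<in> PISO Q d \<Longrightarrow> finite (dom h) \<Longrightarrow> \<exists>f\<in>H. \<forall>x\<in>dom h. h x = Some (f x)"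
    using dense_locally_finite_subgroup[of Q] by auto
  have "dense_pointwise_discrete Q d H"
    unfolding dense_pointwise_discrete_def
  proof (intro ballI allI impI)
    fix g E assume g: "g \<in> carrier (ISO Q d)" and E: "E \<subseteq> Q \<and> finite E"
    have "g ` E \<subseteq> Q"
      using g E isometriesD(5)[of g Q d] by auto
    then have "as_partial E g \<in> PISO Q d"
      using g E by (intro as_partial_PISO[of g Q]) auto
    from ext[OF this] obtain f where "f \<in> H" "\<forall>x\<in>E. as_partial E g x = Some (f x)"
      using E by auto
    then show "\<exists>h\<in>H. \<forall>x\<in>E. h x = g x"
      by (intro bexI[of _ f]) auto
  qed
  with H show ?thesis
    by blast
qed

section \<open>The complete Urysohn space\<close>

lemma countable_separable_space:
  assumes "Metric_space S s" "countable S"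
  shows "separable_space (Metric_space.mtopology S s)"
proof -
  interpret Metric_space S s by fact
  show ?thesis
    unfolding separable_space_def
    using assms(2) by (intro exI[of _ S]) (simp add: closure_of_topspace[of mtopology, simplified])
qed

lemma Urysohn_globalizing_space:
  assumes G: "statement_G" and U: "Urysohn_space U d"
  shows "globalizing_space U d"
proof -
  interpret Metric_space U d
    using U by (simp add: Urysohn_space_def)
  show ?thesis
  proof
    show "ultrahomogeneous U d"
      using U by (simp add: Urysohn_space_def)
    fix E assume E: "E \<subseteq> U" "finite E"
    have "\<exists>(F' :: nat set) r' i T. True \<and> globalization E d F' r' i T"
    proof (rule globalization_of_finite_space)
      show "Metric_space E d"
        using E by (simp add: subspace)
      show "\<exists>(F' :: nat set) r' i T. True \<and> globalization F r F' r' i T"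
        if F: "Metric_space F r" "finite F" for F :: "nat set" and r
        using G F unfolding statement_G_def globalization_def carrier_ISO by metis
    qed (rule E)
    then obtain F' :: "nat set" and r' i T where glob: "globalization E d F' r' i T"
      by blast
    then interpret F': Metric_space F' r'
      by (simp add: globalization_def)
    \<comment> \<open>a copy of \<open>F'\<close> with carrier \<open>real ` F'\<close>; \<open>\<lambda>x. nat \<lfloor>x\<rfloor>\<close> is a left inverse of \<open>real\<close>\<close>
    define s where "s x y = r' (nat \<lfloor>x\<rfloor>) (nat \<lfloor>y\<rfloor>)" for x y :: real
    have "Metric_space (real ` F') s"
      by (unfold_locales) (auto simp: s_def F'.commute F'.triangle)
    moreover have "countable (real ` F')"
      using glob by (simp add: globalization_def countable_finite)
    ultimately obtain j where j: "isometric_embedding (real ` F') s U d j"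
      using U countable_separable_space unfolding Urysohn_space_def by blast
    have "isometric_embedding F' r' U d (\<lambda>n. j (real n))"
      using j by (auto simp: isometric_embedding_def s_def Pi_iff)
    with glob show "\<exists>(F' :: nat set) r' i T j.
        globalization E d F' r' i T \<and> isometric_embedding F' r' U d j"
      by blast
  qed
qed

context Metric_space
begin

text \<open>
  The point \<open>y\<close> is where the continuous extension of \<open>f\<close> sends \<open>x\<close>: the limit of \<open>f (\<sigma> n)\<close> for a
  sequence \<open>\<sigma>\<close> in \<open>X\<close> that converges to \<open>x\<close>. It is described by its distances to the points of
  \<open>f ` X\<close>, a description that mentions no sequence and fixes \<open>y\<close> if \<open>f ` X\<close> is dense.
\<close>

lemma isometry_distance_profile:
  assumes "mcomplete" and "X \<subseteq> M" and dense: "\<And>x e. x \<in> M \<Longrightarrow> e > 0 \<Longrightarrow> \<exists>y\<in>X. d x y < e"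
    and f: "\<And>x. x \<in> X \<Longrightarrow> f x \<in> M" "\<And>x y. x \<in> X \<Longrightarrow> y \<in> X \<Longrightarrow> d (f x) (f y) = d x y"
    and x: "x \<in> M"
  shows "\<exists>y\<in>M. \<forall>s\<in>X. d y (f s) = d x s"
proof -
  have "\<exists>\<sigma>. \<forall>n. \<sigma> n \<in> X \<and> d x (\<sigma> n) < inverse (real (Suc n))"
    using dense[OF x] by (intro choice allI) (metis inverse_positive_iff_positive of_nat_0_less_iff zero_less_Suc)
  then obtain \<sigma> where \<sigma>: "\<And>n. \<sigma> n \<in> X" "\<And>n. d x (\<sigma> n) < inverse (real (Suc n))"
    by blast
  have small: "\<exists>N. \<forall>n\<ge>N. d x (\<sigma> n) < e" if e: "e > 0" for e
  proof -
    obtain N where N: "inverse (real (Suc N)) < e"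
      using reals_Archimedean[OF e] by blast
    have "d x (\<sigma> n) < e" if "N \<le> n" for n
    proof -
      have "inverse (real (Suc n)) \<le> inverse (real (Suc N))"
        using that by (simp add: divide_simps)
      then show ?thesis
        using \<sigma>(2)[of n] N by linarith
    qed
    then show ?thesis
      by blast
  qed
  have M: "\<sigma> n \<in> M" "f (\<sigma> n) \<in> M" for n
    using \<sigma>(1)[of n] f(1) \<open>X \<subseteq> M\<close> by auto
  have "MCauchy (\<lambda>n. f (\<sigma> n))"
    unfolding MCauchy_def
  proof (intro conjI allI impI)
    show "range (\<lambda>n. f (\<sigma> n)) \<subseteq> M"
      using M by auto
    fix e :: real assume "e > 0"
    then obtain N where N: "\<And>n. n \<ge> N \<Longrightarrow> d x (\<sigma> n) < e / 2"
      using small[of "e / 2"] by auto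
    have "d (f (\<sigma> n)) (f (\<sigma> m)) < e" if "N \<le> n" "N \<le> m" for n m
    proof -
      have "d (f (\<sigma> n)) (f (\<sigma> m)) = d (\<sigma> n) (\<sigma> m)"
        using f(2) \<sigma>(1) by simp
      also have "\<dots> \<le> d x (\<sigma> n) + d x (\<sigma> m)"
        using triangle[of "\<sigma> n" x "\<sigma> m"] x M commute[of x "\<sigma> n"] by simp
      also have "\<dots> < e"
        using N[OF that(1)] N[OF that(2)] by linarith
      finally show ?thesis .
    qed
    then show "\<exists>N. \<forall>n n'. N \<le> n \<longrightarrow> N \<le> n' \<longrightarrow> d (f (\<sigma> n)) (f (\<sigma> n')) < e"
      by blast
  qed
  then obtain y where y: "limitin mtopology (\<lambda>n. f (\<sigma> n)) y sequentially"
    using \<open>mcomplete\<close> by (auto simp: mcomplete_def)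
  then have yM: "y \<in> M"
    using limitin_mspace by blast
  have "d y (f s) = d x s" if s: "s \<in> X" for s
  proof -
    have sM: "s \<in> M" "f s \<in> M"
      using s f(1) \<open>X \<subseteq> M\<close> by auto
    have "\<bar>d y (f s) - d x s\<bar> \<le> 0 + e" if "e > 0" for e
    proof -
      obtain N where N: "\<And>n. n \<ge> N \<Longrightarrow> d x (\<sigma> n) < e / 2"
        using small[of "e / 2"] \<open>e > 0\<close> by auto
      have "\<forall>\<^sub>F n in sequentially. f (\<sigma> n) \<in> M \<and> d (f (\<sigma> n)) y < e / 2"
        using y \<open>e > 0\<close> unfolding limitin_metric by (meson half_gt_zero)
      then obtain N' where N': "\<And>n. n \<ge> N' \<Longrightarrow> d (f (\<sigma> n)) y < e / 2"
        by (auto simp: eventually_sequentially)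
      define n where "n = max N N'"
      have "d x (\<sigma> n) < e / 2" "d (f (\<sigma> n)) y < e / 2" "d (f (\<sigma> n)) (f s) = d (\<sigma> n) s"
        using N[of n] N'[of n] f(2)[OF \<sigma>(1) s] by (auto simp: n_def)
      moreover have "d y (f s) \<le> d (f (\<sigma> n)) y + d (f (\<sigma> n)) (f s)"
          "d (f (\<sigma> n)) (f s) \<le> d (f (\<sigma> n)) y + d y (f s)"
        using triangle[of y "f (\<sigma> n)" "f s"] triangle[of "f (\<sigma> n)" y "f s"] yM sM M
          commute[of y "f (\<sigma> n)"] by auto
      moreover have "d x s \<le> d x (\<sigma> n) + d (\<sigma> n) s" "d (\<sigma> n) s \<le> d x (\<sigma> n) + d x s"
        using triangle[of x "\<sigma> n" s] triangle[of "\<sigma> n" x s] x sM M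
          commute[of x "\<sigma> n"] by auto
      ultimately show ?thesis
        by linarith
    qed
    then have "\<bar>d y (f s) - d x s\<bar> \<le> 0"
      by (rule field_le_epsilon)
    then show ?thesis
      by simp
  qed
  then show ?thesis
    using yM by blast
qed

lemma eq_of_equal_profiles:
  assumes dense: "\<And>x e. x \<in> M \<Longrightarrow> e > 0 \<Longrightarrow> \<exists>y\<in>X. d x y < e" and "X \<subseteq> M"
    and x: "x \<in> M" and y: "y \<in> M" and eq: "\<And>s. s \<in> X \<Longrightarrow> d x s = d y s"
  shows "x = y"
proof -
  have "d x y \<le> 0 + e" if e: "e > 0" for e
  proof -
    obtain s where s: "s \<in> X" "d x s < e / 2"
      using dense[OF x, of "e / 2"] e by auto
    then have "d x y \<le> d x s + d y s"
      using triangle[of x s y] commute[of s y] x y \<open>X \<subseteq> M\<close> by auto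
    then show ?thesis
      using s eq[OF s(1)] by linarith
  qed
  then have "d x y \<le> 0"
    by (rule field_le_epsilon)
  then show ?thesis
    using x y nonneg[of x y] by (metis order_antisym zero)
qed

text \<open>
  The extension \<open>g\<close> of \<open>f\<close> is characterized by \<open>d (g x) (f s) = d x s\<close> for all \<open>s\<close> in \<open>X\<close>. As
  \<open>X\<close> is dense, this makes \<open>g\<close> an isometry; and it is onto because the distance profile of the
  inverse of \<open>f\<close> at a point \<open>y\<close> produces a point with the profile that a preimage of \<open>y\<close> has.
\<close>

lemma dense_isometry_core:
  assumes complete: "mcomplete" and XM: "X \<subseteq> M"
    and dense: "\<And>x e. x \<in> M \<Longrightarrow> e > 0 \<Longrightarrow> \<exists>y\<in>X. d x y < e"
  shows "isometry_core M d X"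
  unfolding isometry_core_def
proof (intro conjI ballI impI)
  fix f g assume f: "f \<in> isometries M d" and g: "g \<in> isometries M d" and eq: "\<forall>x\<in>X. f x = g x"
  show "f = g"
  proof (rule isometries_eqI[OF f g])
    fix x assume x: "x \<in> M"
    have fx: "f x \<in> M" "g x \<in> M"
      using isometriesD(5)[OF f x] isometriesD(5)[OF g x] by auto
    have "d (f x) (g x) \<le> 0 + e" if e: "e > 0" for e
    proof -
      obtain s where s: "s \<in> X" "d x s < e / 2"
        using dense[OF x, of "e / 2"] e by auto
      then have sM: "s \<in> M" "f s \<in> M"
        using XM isometriesD(5)[OF f] by auto
      have "d (f x) (g x) \<le> d (f x) (f s) + d (f s) (g x)"
        using triangle fx sM by simp
      also have "f s = g s"
        using eq s by simp
      also have "d (g s) (g x) = d x s"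
        using isometriesD(6)[OF g sM(1) x] commute by simp
      also have "d (f x) (g s) = d x s"
        using isometriesD(6)[OF f x sM(1)] eq s by simp
      finally show ?thesis
        using s by linarith
    qed
    then have "d (f x) (g x) \<le> 0"
      by (rule field_le_epsilon)
    then show "f x = g x"
      using fx nonneg[of "f x" "g x"] by (metis order_antisym zero)
  qed
next
  fix f assume f: "f \<in> isometries X d"
  have fX: "f x \<in> X" "f x \<in> M" if "x \<in> X" for x
    using isometriesD(5)[OF f that] XM by auto
  have "\<forall>x\<in>M. \<exists>y. y \<in> M \<and> (\<forall>s\<in>X. d y (f s) = d x s)"
    using isometry_distance_profile[OF complete XM dense fX(2) isometriesD(6)[OF f]] by blast
  from bchoice[OF this] obtain g0
    where g0: "\<forall>x\<in>M. g0 x \<in> M \<and> (\<forall>s\<in>X. d (g0 x) (f s) = d x s)"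
    by blast
  define g where "g = restrict g0 M"
  have gM: "g x \<in> M" and gd: "s \<in> X \<Longrightarrow> d (g x) (f s) = d x s" if "x \<in> M" for x s
    using g0 that by (auto simp: g_def)
  have dense_f: "\<exists>t\<in>X. d y (f t) < e" if y: "y \<in> M" "e > 0" for y e
  proof -
    obtain s where "s \<in> X" "d y s < e"
      using dense[OF y] by blast
    moreover obtain t where "t \<in> X" "f t = s"
      using isometriesD(4)[OF f] \<open>s \<in> X\<close> by (metis imageE)
    ultimately show ?thesis
      by auto
  qed
  have "g \<in> isometries M d"
  proof (rule isometriesI_surj)
    show "g ` M = M"
    proof (rule subset_antisym)
      show "g ` M \<subseteq> M"
        using gM by auto
      show "M \<subseteq> g ` M"
      proof
        fix y assume y: "y \<in> M"
        let ?f' = "inv_into X f"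
        have f': "?f' t \<in> X" "f (?f' t) = t" if "t \<in> X" for t
          using that isometriesD(4)[OF f] by (auto simp: inv_into_into f_inv_into_f)
        have "d (?f' s) (?f' t) = d s t" if "s \<in> X" "t \<in> X" for s t
          using isometriesD(6)[OF f f'(1)[OF that(1)] f'(1)[OF that(2)]] f'(2) that by simp
        moreover have "?f' t \<in> M" if "t \<in> X" for t
          using f'(1)[OF that] XM by auto
        ultimately obtain x where x: "x \<in> M" "\<forall>s\<in>X. d x (?f' s) = d y s"
          using isometry_distance_profile[OF complete XM dense, of ?f' y] y by blast
        have "g x = y"
        proof (rule eq_of_equal_profiles[OF dense XM])
          fix s assume s: "s \<in> X"
          have "d (g x) s = d x (?f' s)"
            using gd[OF x(1) f'(1)[OF s]] f'(2)[OF s] by simp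
          then show "d (g x) s = d y s"
            using x(2) s by simp
        qed (use x y gM in auto)
        then show "y \<in> g ` M"
          using x by blast
      qed
    qed
    fix x y assume x: "x \<in> M" and y: "y \<in> M"
    have "\<bar>d (g x) (g y) - d x y\<bar> \<le> 0 + e" if e: "e > 0" for e
    proof -
      obtain s where s: "s \<in> X" "d y s < e / 2"
        using dense[OF y, of "e / 2"] e by auto
      then have sM: "s \<in> M" "f s \<in> M"
        using XM fX by auto
      have "d (g x) (f s) = d x s" "d (g y) (f s) = d y s"
        using gd x y s by auto
      moreover have "d (g x) (g y) \<le> d (g x) (f s) + d (g y) (f s)"
          "d (g x) (f s) \<le> d (g x) (g y) + d (g y) (f s)"
        using triangle[of "g x" "f s" "g y"] triangle[of "g x" "g y" "f s"] gM x y sM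
          commute[of "f s" "g y"] by auto
      moreover have "d x y \<le> d x s + d y s" "d x s \<le> d x y + d y s"
        using triangle[of x s y] triangle[of x y s] x y sM commute[of s y] by auto
      ultimately show ?thesis
        using s(2) by linarith
    qed
    then have "\<bar>d (g x) (g y) - d x y\<bar> \<le> 0"
      by (rule field_le_epsilon)
    then show "d (g x) (g y) = d x y"
      by simp
  qed (auto simp: g_def)
  moreover have "g s = f s" if s: "s \<in> X" for s
  proof -
    have "d (g s) (f s) = 0"
      using gd[of s s] s XM by auto
    then show ?thesis
      using gM fX s XM by (metis subsetD zero)
  qed
  ultimately show "\<exists>g\<in>isometries M d. \<forall>x\<in>X. g x = f x"
    by blast
qed (rule XM)

text \<open>
  The group of isometries is separable for pointwise convergence on \<open>C\<close>. For each finite set of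
  demands, that certain points of \<open>C\<close> be moved to within \<open>1 / (n + 1)\<close> of certain points of \<open>C\<close>,
  one isometry is chosen that meets them, if there is any. The demands are countable in number.
\<close>

lemma countable_dense_isometries:
  assumes C: "countable C" "C \<subseteq> M"
    and dense: "\<And>x e. x \<in> M \<Longrightarrow> e > 0 \<Longrightarrow> \<exists>y\<in>C. d x y < e"
  shows "\<exists>\<Gamma>\<subseteq>isometries M d. countable \<Gamma> \<and>
    (\<forall>g\<in>isometries M d. \<forall>E\<subseteq>C. \<forall>e>0. finite E \<longrightarrow> (\<exists>\<gamma>\<in>\<Gamma>. \<forall>x\<in>E. d (\<gamma> x) (g x) < e))"
proof -
  define near where "near = (\<lambda>(S, n) \<gamma>. \<gamma> \<in> isometries M d \<and>
      (\<forall>(x, y)\<in>S. d (\<gamma> x) y < inverse (real (Suc n))))"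
  define I where "I = {S. finite S \<and> S \<subseteq> C \<times> C} \<times> (UNIV :: nat set)"
  define \<Gamma> where "\<Gamma> = (\<lambda>p. SOME \<gamma>. near p \<gamma>) ` {p \<in> I. \<exists>\<gamma>. near p \<gamma>}"
  have "countable I"
    unfolding I_def using C(1) by (intro countable_SIGMA countable_Collect_finite_subset) auto
  then have "countable \<Gamma>"
    unfolding \<Gamma>_def by (intro countable_image) (rule countable_subset[of _ I], auto)
  moreover have "\<Gamma> \<subseteq> isometries M d"
  proof
    fix \<gamma> assume "\<gamma> \<in> \<Gamma>"
    then obtain p where "\<exists>\<gamma>. near p \<gamma>" "\<gamma> = (SOME \<gamma>. near p \<gamma>)"
      unfolding \<Gamma>_def by blast
    then have "near p \<gamma>"
      using someI_ex by metis
    then show "\<gamma> \<in> isometries M d"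
      by (cases p) (simp add: near_def)
  qed
  moreover have "\<exists>\<gamma>\<in>\<Gamma>. \<forall>x\<in>E. d (\<gamma> x) (g x) < e"
    if g: "g \<in> isometries M d" and E: "E \<subseteq> C" "finite E" and e: "e > 0" for g E e
  proof -
    obtain n where n: "inverse (real (Suc n)) < e / 2"
      using reals_Archimedean[of "e / 2"] e by auto
    have gM: "g x \<in> M" if "x \<in> E" for x
      using isometriesD(5)[OF g] that E C by auto
    have "\<forall>x\<in>E. \<exists>y. y \<in> C \<and> d (g x) y < inverse (real (Suc n))"
      using dense[OF gM] by (metis inverse_positive_iff_positive of_nat_0_less_iff zero_less_Suc)
    from bchoice[OF this] obtain a
      where a: "\<And>x. x \<in> E \<Longrightarrow> a x \<in> C" "\<And>x. x \<in> E \<Longrightarrow> d (g x) (a x) < inverse (real (Suc n))"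
      by blast
    let ?p = "((\<lambda>x. (x, a x)) ` E, n)"
    have "near ?p g"
      using g a(2) by (simp add: near_def)
    then have near: "near ?p (SOME \<gamma>. near ?p \<gamma>)"
      by (rule someI[of "near ?p"])
    have "?p \<in> I"
      using E a(1) by (auto simp: I_def)
    then have "(SOME \<gamma>. near ?p \<gamma>) \<in> \<Gamma>"
      unfolding \<Gamma>_def using \<open>near ?p g\<close> by blast
    moreover have "d (\<gamma> x) (g x) < e" if \<gamma>: "near ?p \<gamma>" and x: "x \<in> E" for \<gamma> x
    proof -
      have "\<gamma> \<in> isometries M d" and close: "d (\<gamma> x) (a x) < inverse (real (Suc n))"
        using \<gamma> x by (auto simp: near_def)
      then have "\<gamma> x \<in> M" "a x \<in> M"
        using isometriesD(5)[of \<gamma> M d x] x E C a(1) by auto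
      then have "d (\<gamma> x) (g x) \<le> d (\<gamma> x) (a x) + d (g x) (a x)"
        using triangle[of "\<gamma> x" "a x" "g x"] gM[OF x] commute[of "a x" "g x"] by simp
      then show ?thesis
        using close a(2)[OF x] n by linarith
    qed
    ultimately show ?thesis
      using near by blast
  qed
  ultimately show ?thesis
    by blast
qed

lemma dense_pointwiseI:
  assumes H: "H \<subseteq> isometries M d"
    and approx: "\<And>g E e. g \<in> isometries M d \<Longrightarrow> E \<subseteq> M \<Longrightarrow> finite E \<Longrightarrow> e > 0 \<Longrightarrow>
      \<exists>f\<in>H. \<forall>x\<in>E. d (g x) (f x) < e"
  shows "dense_pointwise M d H"
  unfolding dense_pointwise_def carrier_ISO
proof (rule subset_antisym)
  let ?P = "product_topology (\<lambda>_. mtopology) M"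
  have top: "isometries M d \<subseteq> topspace ?P"
    using isometriesD(1,5) by (auto simp: PiE_def)
  then have top': "topspace (pointwise_topology M d) = isometries M d"
    by (auto simp: pointwise_topology_def)
  show "(pointwise_topology M d) closure_of H \<subseteq> isometries M d"
    using closure_of_subset_topspace[of "pointwise_topology M d" H] by (simp only: top')
  show "isometries M d \<subseteq> (pointwise_topology M d) closure_of H"
  proof
    fix g assume g: "g \<in> isometries M d"
    have "\<exists>f\<in>H. f \<in> W" if W: "g \<in> W" "openin (pointwise_topology M d) W" for W
    proof -
      obtain V where V: "openin ?P V" "W = V \<inter> isometries M d"
        using W(2) by (auto simp: pointwise_topology_def openin_subtopology)
      then have "g \<in> V"
        using W(1) by simp
      then obtain B where B: "finite {x \<in> M. B x \<noteq> topspace mtopology}"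
          "\<And>x. x \<in> M \<Longrightarrow> openin mtopology (B x)" "g \<in> Pi\<^sub>E M B" "Pi\<^sub>E M B \<subseteq> V"
        using V(1) unfolding openin_product_topology_alt by meson
      define E where "E = {x \<in> M. B x \<noteq> M}"
      have E: "finite E" "E \<subseteq> M"
        using B(1) by (auto simp: E_def)
      have "\<forall>x\<in>E. \<exists>r. r > 0 \<and> mball (g x) r \<subseteq> B x"
      proof
        fix x assume "x \<in> E"
        then have "x \<in> M" "g x \<in> B x"
          using E B(3) by auto
        then show "\<exists>r. r > 0 \<and> mball (g x) r \<subseteq> B x"
          using B(2)[of x] by (auto simp: openin_mtopology)
      qed
      from bchoice[OF this] obtain r
        where r: "\<And>x. x \<in> E \<Longrightarrow> r x > 0" "\<And>x. x \<in> E \<Longrightarrow> mball (g x) (r x) \<subseteq> B x"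
        by blast
      define e where "e = Min (insert 1 (r ` E))"
      have e: "e > 0" "\<And>x. x \<in> E \<Longrightarrow> e \<le> r x"
        using E r(1) by (auto simp: e_def)
      obtain f where f: "f \<in> H" "\<And>x. x \<in> E \<Longrightarrow> d (g x) (f x) < e"
        using approx[OF g E(2,1) e(1)] by blast
      have fM: "f \<in> isometries M d"
        using f(1) H by blast
      have "f x \<in> B x" if x: "x \<in> M" for x
      proof (cases "x \<in> E")
        case True
        then have "f x \<in> mball (g x) (r x)"
          using f(2)[OF True] e(2)[OF True] isometriesD(5)[OF fM x] isometriesD(5)[OF g x] by simp
        then show ?thesis
          using r(2)[OF True] by blast
      next
        case False
        then show ?thesis
          using x isometriesD(5)[OF fM x] by (simp add: E_def)
      qed
      then have "f \<in> Pi\<^sub>E M B"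
        using isometriesD(1)[OF fM] by (simp add: PiE_def Pi_iff)
      then show ?thesis
        using f(1) fM B(4) V(2) by blast
    qed
    then show "g \<in> (pointwise_topology M d) closure_of H"
      using g by (auto simp: in_closure_of top')
  qed
qed

end

text \<open>
  A finite subset of a countable dense set \<open>C\<close> need not be mapped into \<open>C\<close>, nor into any given
  countable set, by an isometry \<open>g\<close> of the space. Thus the tower has to be built around a set \<open>D\<close>
  that also contains the images of \<open>C\<close> under a countable set \<open>\<Gamma>\<close> of isometries that is dense for
  pointwise convergence on \<open>C\<close>. Then \<open>g\<close> is approximated by some \<open>\<gamma>\<close> in \<open>\<Gamma>\<close> on finitely many
  points of \<open>C\<close>, and there \<open>\<gamma>\<close> is a finite partial isometry of \<open>D\<close>, which an element of the
  locally finite group extends.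
\<close>

lemma dense_locally_finite_Urysohn:
  assumes G: "statement_G" and U: "Urysohn_space U d"
  shows "\<exists>H. subgroup H (ISO U d) \<and> locally_finite_group (ISO U d \<lparr>carrier := H\<rparr>) \<and>
    dense_pointwise U d H"
proof -
  interpret globalizing_space U d
    using assms by (rule Urysohn_globalizing_space)
  have complete: "mcomplete"
    using U by (simp add: Urysohn_space_def)
  obtain C where C: "countable C" "C \<subseteq> U" "mtopology closure_of C = U"
    using U by (auto simp: Urysohn_space_def separable_space_def)
  have dense: "\<exists>y\<in>C. d x y < e" if "x \<in> U" "e > 0" for x e
  proof -
    have "x \<in> mtopology closure_of C"
      using C(3) that(1) by simp
    then show ?thesis
      using that(2) unfolding metric_closure_of by auto
  qed
  have "\<exists>\<Gamma>\<subseteq>isometries U d. countable \<Gamma> \<and>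
      (\<forall>g\<in>isometries U d. \<forall>E\<subseteq>C. \<forall>e>0. finite E \<longrightarrow> (\<exists>\<gamma>\<in>\<Gamma>. \<forall>x\<in>E. d (\<gamma> x) (g x) < e))"
    using C(1,2) dense by (rule countable_dense_isometries)
  then obtain \<Gamma> where \<Gamma>: "\<Gamma> \<subseteq> isometries U d" "countable \<Gamma>"
    and near: "\<forall>g\<in>isometries U d. \<forall>E\<subseteq>C. \<forall>e>0. finite E \<longrightarrow> (\<exists>\<gamma>\<in>\<Gamma>. \<forall>x\<in>E. d (\<gamma> x) (g x) < e)"
    by (elim exE conjE) (rule that)
  define D where "D = C \<union> (\<Union>\<gamma>\<in>\<Gamma>. \<gamma> ` C)"
  have "countable D"
    using C(1) \<Gamma>(2) by (simp add: D_def)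
  moreover have DU: "D \<subseteq> U"
    using C(2) \<Gamma>(1) isometriesD(5)[of _ U d] by (auto simp: D_def)
  moreover have "isometry_core U d X" if "D \<subseteq> X" "X \<subseteq> U" for X
  proof (rule dense_isometry_core[OF complete that(2)])
    show "\<exists>y\<in>X. d x y < e" if "x \<in> U" "e > 0" for x e
      using dense[OF that] \<open>D \<subseteq> X\<close> by (auto simp: D_def)
  qed
  ultimately obtain H where H: "subgroup H (ISO U d)"
      "locally_finite_group (ISO U d \<lparr>carrier := H\<rparr>)"
    and ext: "\<And>h. h \<in> PISO D d \<Longrightarrow> finite (dom h) \<Longrightarrow> \<exists>f\<in>H. \<forall>x\<in>dom h. h x = Some (f x)"
    using dense_locally_finite_subgroup[of D] by auto
  have HU: "H \<subseteq> isometries U d"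
    using subgroup.subset[OF H(1)] by simp
  have "dense_pointwise U d H"
  proof (rule dense_pointwiseI[OF HU])
    fix g E and e :: real assume g: "g \<in> isometries U d" and E: "E \<subseteq> U" "finite E" and e: "e > 0"
    have "\<forall>x\<in>E. \<exists>y. y \<in> C \<and> d x y < e / 3"
      using dense[of _ "e / 3"] E e by (auto simp: Bex_def subset_iff)
    from bchoice[OF this] obtain a where a: "\<And>x. x \<in> E \<Longrightarrow> a x \<in> C" "\<And>x. x \<in> E \<Longrightarrow> d x (a x) < e / 3"
      by blast
    have aC: "a ` E \<subseteq> C" "finite (a ` E)"
      using a(1) E by auto
    then obtain \<gamma> where \<gamma>: "\<gamma> \<in> \<Gamma>" "\<And>x. x \<in> E \<Longrightarrow> d (\<gamma> (a x)) (g (a x)) < e / 3"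
      using near[rule_format, OF g aC(1), of "e / 3"] e by auto
    have "\<gamma> ` a ` E \<subseteq> D" "a ` E \<subseteq> D"
      using \<gamma>(1) aC(1) by (auto simp: D_def)
    then have "as_partial (a ` E) \<gamma> \<in> PISO D d"
      using \<gamma>(1) \<Gamma>(1) DU by (intro as_partial_PISO[of \<gamma> U]) auto
    from ext[OF this] obtain f where f: "f \<in> H" "\<And>x. x \<in> E \<Longrightarrow> f (a x) = \<gamma> (a x)"
      using aC(2) by auto
    have fU: "f \<in> isometries U d"
      using f(1) HU by blast
    have "d (g x) (f x) < e" if x: "x \<in> E" for x
    proof -
      have xU: "x \<in> U" "a x \<in> U"
        using x E a(1)[OF x] C(2) by auto
      then have mem: "g x \<in> U" "g (a x) \<in> U" "f x \<in> U" "f (a x) \<in> U"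
        using isometriesD(5)[OF g] isometriesD(5)[OF fU] by auto
      have "d (g x) (f x) \<le> d (g x) (g (a x)) + d (g (a x)) (f x)"
        using mem by (intro triangle)
      also have "d (g (a x)) (f x) \<le> d (g (a x)) (f (a x)) + d (f (a x)) (f x)"
        using mem by (intro triangle)
      also have "d (g x) (g (a x)) = d x (a x)"
        by (rule isometriesD(6)[OF g xU])
      also have "d (f (a x)) (f x) = d x (a x)"
        using isometriesD(6)[OF fU xU(2,1)] commute by simp
      also have "d (g (a x)) (f (a x)) = d (\<gamma> (a x)) (g (a x))"
        using f(2)[OF x] commute by simp
      finally show ?thesis
        using a(2)[OF x] \<gamma>(2)[OF x] by linarith
    qed
    with f(1) show "\<exists>f\<in>H. \<forall>x\<in>E. d (g x) (f x) < e"
      by blast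
  qed
  with H show ?thesis
    by blast
qed

theorem theorem3:
  assumes "statement_G"
  shows "(\<forall>(U :: 'u set) d. Urysohn_space U d \<longrightarrow>
            (\<exists>H. subgroup H (ISO U d) \<and>
                 locally_finite_group (ISO U d \<lparr>carrier := H\<rparr>) \<and>
                 dense_pointwise U d H)) \<and>
         (\<forall>(Q :: 'q set) d. rational_Urysohn_space Q d \<longrightarrow>
            (\<exists>H. subgroup H (ISO Q d) \<and>
                 locally_finite_group (ISO Q d \<lparr>carrier := H\<rparr>) \<and>
                 dense_pointwise_discrete Q d H))"
  using assms dense_locally_finite_Urysohn dense_locally_finite_rational_Urysohn by blast

end
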